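(* Let $(M,\widetilde B)$ be a strict root of unity quantum seed with respect to a skew-symmetric integer matrix $\Lambda\in M_N(\mathbb Z)$, let $(M_q,\widetilde B)$ be the associated quantum seed and $\kappa_\varepsilon:\mathcal T_q(M_q)\to\mathcal T_\varepsilon(M)$ the associated specialization map, and let $\mathrm{inv}\subseteq[1,N]\setminus\mathrm{ex}$. Then there is an isomorphism of $\mathbb Z[\varepsilon^{1/2}]$-algebras $$\kappa_\varepsilon\big(\mathcal A_q(M_q,\widetilde B,\mathrm{inv})\big)\cong\mathcal A_\varepsilon(M,\widetilde B,\mathrm{inv}).$$
   Context: Root of unity setting: $\ell$ a positive integer, $\mathbb Z_\ell=\mathbb Z/\ell\mathbb Z$, $\varepsilon^{1/2}\in\mathbb C$ a primitive $\ell$-th root of unity, $\mathcal A^{1/2}_\varepsilon=\mathbb Z[\varepsilon^{1/2}]$, $\varepsilon^{a/2}=(\varepsilon^{1/2})^a$; $\overline C$ = reduction mod $\ell$; $e_1,\dots,e_N$ standard basis. For skew-symmetric $\Lambda:\mathbb Z^N\times\mathbb Z^N\to\mathbb Z_\ell$, $\mathcal T_\varepsilon(\Lambda)$ has $\mathcal A^{1/2}_\varepsilon$-basis $X^f$ ($f\in\mathbb Z^N$) with $X^fX^g=\varepsilon^{\Lambda(f,g)/2}X^{f+g}$; a root of unity toric frame of a division algebra $\mathcal F$ over $\mathbb Q(\varepsilon^{1/2})$ is $M:\mathbb Z^N\to\mathcal F$ with $f\mapsto M(f)$ extending to an injective algebra map from some (unique) $\mathcal T_\varepsilon(\Lambda_M)$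 whose image generates $\mathcal F$ as a skew field; $\mathcal T_\varepsilon(M)$ is that image. Fix $\mathrm{ex}\subseteq[1,N]$; $\widetilde B=(b_{ij})$ integer, rows $[1,N]$, columns $\mathrm{ex}$, principal part $B$, columns $b^k$. $\ell$-compatibility w.r.t. $D=\mathrm{diag}(d_j)_{j\in\mathrm{ex}}$ ($d_j>0$): $DB$ skew-symmetric and $\sum_k\overline b_{kj}(\Lambda_M)_{ki}=\delta_{ij}\overline d_j$ mod $\ell$; seeds $(M,\widetilde B)$ are pairs with this property; mutation: $\mu_k(\widetilde B)$ has entries $-b_{ij}$ if $i=k$ or $j=k$ and $b_{ij}+(|b_{ik}|b_{kj}+b_{ik}|b_{kj}|)/2$ otherwise; $\mu_k(M)$ is the frame with matrix $\overline E^\top\Lambda_M\overline E$ ($e_{ij}=\delta_{ij}$ for $j\ne k$, $e_{kk}=-1$, $e_{ik}=\max(0,-b_{ik})$) with $\mu_k(M)(e_j)=M(e_j)$ for $j\ne k$ and $\mu_k(M)(e_k)=M(-e_k+[b^k]_+)+M(-e_k-[b^k]_-)$ ($[b]_\pm$ keeps entries with $\pm b_i\ge0$). $\mathcal A_\varepsilon(M,\widetilde B,\mathrm{inv})$ is the $\mathcal A^{1/2}_\varepsilon$-algebra generated by all cluster variables $M'(e_i)$ of mutation-equivalent seeds and $M(e_j)^{-1}$, $j\in\mathrm{inv}$. Quantum setting: $\mathcal A^{1/2}_q=\mathbb Z[q^{\pm1/2}]$; for skew-symmetric integer $\Lambda$, $\mathcal T_q(\Lambda)$ has $\mathcal A^{1/2}_q$-basis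 $X^f$ with $X^fX^g=q^{\Lambda(f,g)/2}X^{f+g}$; toric frames $M_q$ of division algebras over $\mathbb Q(q^{1/2})$ are defined analogously, $\Lambda_{M_q}\in M_N(\mathbb Z)$; $(\Lambda,\widetilde B)$ is compatible w.r.t. $D$ if $\sum_kb_{kj}\lambda_{ki}=\delta_{ij}d_j$; quantum seeds, their mutations (same formulas, with $E^\top\Lambda E$), and $\mathcal A_q(M_q,\widetilde B,\mathrm{inv})$ (the $\mathcal A^{1/2}_q$-algebra generated by cluster variables of mutation-equivalent quantum seeds and $M_q(e_j)^{-1}$, $j\in\mathrm{inv}$) are defined analogously; by the quantum Laurent phenomenon $\mathcal A_q(M_q,\widetilde B,\mathrm{inv})\subseteq\mathcal T_q(M_q)$. Strictness: $(M,\widetilde B)$ is strict w.r.t. $\Lambda\in M_N(\mathbb Z)$ skew-symmetric if $\overline\Lambda=\Lambda_M$ and $(\Lambda,\widetilde B)$ is compatible w.r.t. the same $D$. The associated quantum seed is $(M_q,\widetilde B)$ in $\mathcal F_q=\mathrm{Fract}(\mathcal T_q(\Lambda))$ with $M_q(f)=X^f$, $\Lambda_{M_q}=\Lambda$; the specialization map $\kappa_\varepsilon:\mathcal T_q(M_q)\to\mathcal T_\varepsilon(M)$ is the surjective ring homomorphism with $q^{1/2}\mapsto\varepsilon^{1/2}$ and $M_q(f)\mapsto M(f)$, whose kernel is generated by $\Phi_\ell(q^{1/2})$, $\Phi_\ell$ the $\ell$-th cyclotomic polynomial. *)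

theory Defs
  imports Complex_Main "HOL-Computational_Algebra.Polynomial"
begin

text \<open>Index set [1,N] is modelled by a finite type 'n; vectors in Z^N are functions 'n => int.\<close>

definition evalp :: "int poly \<Rightarrow> 'a::ring_1 \<Rightarrow> 'a" where
  "evalp p x = (\<Sum>i\<le>degree p. of_int (coeff p i) * x ^ i)"

definition unitv :: "'n \<Rightarrow> 'n \<Rightarrow> int" where
  "unitv j = (\<lambda>i. if i = j then 1 else 0)"

definition bil :: "('n::finite \<Rightarrow> 'n \<Rightarrow> int) \<Rightarrow> ('n \<Rightarrow> int) \<Rightarrow> ('n \<Rightarrow> int) \<Rightarrow> int" where
  "bil L f g = (\<Sum>i\<in>UNIV. \<Sum>j\<in>UNIV. f i * L i j * g j)"

definition central :: "'a::ring \<Rightarrow> bool" where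
  "central z \<longleftrightarrow> (\<forall>x. z * x = x * z)"

definition generates_skew_field :: "'a::division_ring set \<Rightarrow> bool" where
  "generates_skew_field S \<longleftrightarrow>
     (\<forall>T. 0 \<in> T \<and> 1 \<in> T \<and> (\<forall>x\<in>T. \<forall>y\<in>T. x + y \<in> T \<and> x * y \<in> T) \<and>
          (\<forall>x\<in>T. - x \<in> T \<and> inverse x \<in> T) \<and> S \<subseteq> T \<longrightarrow> T = UNIV)"

text \<open>Root of unity toric frame with matrix (the reduction mod l of) L; eh is the image of
  eps^(1/2). Coefficients in Z[eps^(1/2)] are values of integer polynomials at eh.\<close>
definition rou_frame :: "nat \<Rightarrow> 'f::division_ring \<Rightarrow> (('n::finite \<Rightarrow> int) \<Rightarrow> 'f) \<Rightarrow> ('n \<Rightarrow> 'n \<Rightarrow> int) \<Rightarrow> bool" where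
  "rou_frame l eh M L \<longleftrightarrow>
     (\<forall>f g. M f * M g = eh ^ nat (bil L f g mod int l) * M (\<lambda>i. f i + g i)) \<and>
     (\<forall>S p. finite S \<and> (\<Sum>f\<in>S. evalp (p f) eh * M f) = 0 \<longrightarrow> (\<forall>f\<in>S. evalp (p f) eh = 0)) \<and>
     generates_skew_field (insert eh (range M))"

text \<open>Quantum toric frame with integer matrix L; qh is the image of q^(1/2).
  Linear independence over Z[q^(+-1/2)] is equivalent (qh central invertible) to
  independence with polynomial coefficients.\<close>
definition q_frame :: "'g::division_ring \<Rightarrow> (('n::finite \<Rightarrow> int) \<Rightarrow> 'g) \<Rightarrow> ('n \<Rightarrow> 'n \<Rightarrow> int) \<Rightarrow> bool" where
  "q_frame qh M L \<longleftrightarrow>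
     (\<forall>f g. M f * M g = qh powi (bil L f g) * M (\<lambda>i. f i + g i)) \<and>
     (\<forall>S p. finite S \<and> (\<Sum>f\<in>S. evalp (p f) qh * M f) = 0 \<longrightarrow> (\<forall>f\<in>S. p f = 0)) \<and>
     generates_skew_field (insert qh (range M))"

definition mutB :: "'n \<Rightarrow> ('n \<Rightarrow> 'n \<Rightarrow> int) \<Rightarrow> ('n \<Rightarrow> 'n \<Rightarrow> int)" where
  "mutB k B = (\<lambda>i j. if i = k \<or> j = k then - B i j
                     else B i j + (\<bar>B i k\<bar> * B k j + B i k * \<bar>B k j\<bar>) div 2)"

definition mutE :: "'n \<Rightarrow> ('n \<Rightarrow> 'n \<Rightarrow> int) \<Rightarrow> ('n \<Rightarrow> 'n \<Rightarrow> int)" where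
  "mutE k B = (\<lambda>i j. if j \<noteq> k then (if i = j then 1 else 0)
                     else if i = k then -1 else max 0 (- B i k))"

definition mutL :: "'n \<Rightarrow> ('n \<Rightarrow> 'n \<Rightarrow> int) \<Rightarrow> ('n::finite \<Rightarrow> 'n \<Rightarrow> int) \<Rightarrow> ('n \<Rightarrow> 'n \<Rightarrow> int)" where
  "mutL k B L = (\<lambda>a b. \<Sum>i\<in>UNIV. \<Sum>j\<in>UNIV. mutE k B i a * L i j * mutE k B j b)"

text \<open>One mutation step at k in ex of a seed (M, B, L), where L is the (integer lift of the)
  frame matrix; frame is the appropriate toric-frame predicate.\<close>
definition mut_step ::
  "'n set \<Rightarrow> ((('n::finite \<Rightarrow> int) \<Rightarrow> 'a::ring) \<Rightarrow> ('n \<Rightarrow> 'n \<Rightarrow> int) \<Rightarrow> bool) \<Rightarrow>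
   (('n \<Rightarrow> int) \<Rightarrow> 'a) \<times> ('n \<Rightarrow> 'n \<Rightarrow> int) \<times> ('n \<Rightarrow> 'n \<Rightarrow> int) \<Rightarrow>
   (('n \<Rightarrow> int) \<Rightarrow> 'a) \<times> ('n \<Rightarrow> 'n \<Rightarrow> int) \<times> ('n \<Rightarrow> 'n \<Rightarrow> int) \<Rightarrow> bool" where
  "mut_step ex frame s s' \<longleftrightarrow>
     (case s of (M, B, L) \<Rightarrow> case s' of (M', B', L') \<Rightarrow>
       (\<exists>k\<in>ex. B' = mutB k B \<and> L' = mutL k B L \<and> frame M' L' \<and>
          (\<forall>j. j \<noteq> k \<longrightarrow> M' (unitv j) = M (unitv j)) \<and>
          M' (unitv k) = M (\<lambda>i. - unitv k i + max 0 (B i k))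
                       + M (\<lambda>i. - unitv k i - min 0 (B i k))))"

definition cluster_vars ::
  "'n set \<Rightarrow> ((('n::finite \<Rightarrow> int) \<Rightarrow> 'a::ring) \<Rightarrow> ('n \<Rightarrow> 'n \<Rightarrow> int) \<Rightarrow> bool) \<Rightarrow>
   (('n \<Rightarrow> int) \<Rightarrow> 'a) \<Rightarrow> ('n \<Rightarrow> 'n \<Rightarrow> int) \<Rightarrow> ('n \<Rightarrow> 'n \<Rightarrow> int) \<Rightarrow> 'a set" where
  "cluster_vars ex frame M B L =
     {M' (unitv i) | M' B' L' i. (mut_step ex frame)\<^sup>*\<^sup>* (M, B, L) (M', B', L')}"

inductive_set subring_gen :: "'a::ring_1 set \<Rightarrow> 'a set" for G where
  base: "x \<in> G \<Longrightarrow> x \<in> subring_gen G"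
| zero: "0 \<in> subring_gen G"
| one: "1 \<in> subring_gen G"
| add: "x \<in> subring_gen G \<Longrightarrow> y \<in> subring_gen G \<Longrightarrow> x + y \<in> subring_gen G"
| neg: "x \<in> subring_gen G \<Longrightarrow> - x \<in> subring_gen G"
| mult: "x \<in> subring_gen G \<Longrightarrow> y \<in> subring_gen G \<Longrightarrow> x * y \<in> subring_gen G"

definition A_eps :: "nat \<Rightarrow> 'f::division_ring \<Rightarrow> 'n set \<Rightarrow> (('n::finite \<Rightarrow> int) \<Rightarrow> 'f) \<Rightarrow>
    ('n \<Rightarrow> 'n \<Rightarrow> int) \<Rightarrow> ('n \<Rightarrow> 'n \<Rightarrow> int) \<Rightarrow> 'n set \<Rightarrow> 'f set" where
  "A_eps l eh ex M B L invs = subring_gen ({eh} \<union> cluster_vars ex (rou_frame l eh) M B L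
       \<union> {inverse (M (unitv j)) | j. j \<in> invs})"

definition A_q :: "'g::division_ring \<Rightarrow> 'n set \<Rightarrow> (('n::finite \<Rightarrow> int) \<Rightarrow> 'g) \<Rightarrow>
    ('n \<Rightarrow> 'n \<Rightarrow> int) \<Rightarrow> ('n \<Rightarrow> 'n \<Rightarrow> int) \<Rightarrow> 'n set \<Rightarrow> 'g set" where
  "A_q qh ex M B L invs = subring_gen ({qh, inverse qh} \<union> cluster_vars ex (q_frame qh) M B L
       \<union> {inverse (M (unitv j)) | j. j \<in> invs})"

definition kappa_image :: "'g::division_ring \<Rightarrow> (('n \<Rightarrow> int) \<Rightarrow> 'g) \<Rightarrow>
    'f::division_ring \<Rightarrow> (('n \<Rightarrow> int) \<Rightarrow> 'f) \<Rightarrow> 'g set \<Rightarrow> 'f set" where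
  "kappa_image qh Mq eh M X =
     {y. \<exists>x\<in>X. \<exists>S c. finite S \<and>
          x = (\<Sum>(f, a)\<in>S. of_int (c f a) * qh powi a * Mq f) \<and>
          y = (\<Sum>(f, a)\<in>S. of_int (c f a) * eh powi a * M f)}"

definition alg_iso_eps :: "'f::ring_1 \<Rightarrow> 'f set \<Rightarrow> 'f set \<Rightarrow> bool" where
  "alg_iso_eps eh S T \<longleftrightarrow> (\<exists>\<phi>. bij_betw \<phi> S T \<and>
      (\<forall>x\<in>S. \<forall>y\<in>S. \<phi> (x + y) = \<phi> x + \<phi> y \<and> \<phi> (x * y) = \<phi> x * \<phi> y) \<and>
      \<phi> 1 = 1 \<and> (\<forall>x\<in>S. \<phi> (eh * x) = eh * \<phi> x))"

end

theory Submission
  imports Defs "HOL-Library.Function_Algebras"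
begin

text \<open>Both kinds of frames are treated uniformly as families \<open>M f\<close> that multiply up to powers of a central
  unit \<open>h\<close> and are independent over \<open>\<int>[h, h\<^sup>-\<^sup>1]\<close>. A compatible seed can be mutated in every direction of
  \<open>ex\<close>, so quantum and root of unity mutation sequences correspond to each other, and it remains to
  compare the cluster variables. By the quantum Laurent phenomenon a quantum cluster variable lies in the
  initial torus, where the specialization is defined; multiplying its exchange relation by the variable
  it replaces and cancelling the specialized factor shows that it specializes to the
  corresponding root of unity cluster variable. Hence the two algebras are even equal.

  The Laurent phenomenon follows from the mutation invariance of the intersection of the torus of a
  seed with the tori of its neighbours. This is a statement about two directions, proved by comparing
  the expansions of an element in several tori graded by a functional that kills a column of the
  exchange matrix.\<close>

section \<open>Evaluation of integer polynomials\<close>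

text \<open>The obstacle is that specialization is defined only on the initial torus and has a
  kernel, while a mutation sequence divides by intermediate cluster variables, so a division cannot
  simply be carried over. Quantum cluster variables must therefore be known to lie in the torus
  before they can be specialized at all. In the commutative theory, mutation invariance of upper
  bounds rests on coprimality of exchange binomials in a factorial ring, which a quantum torus is
  not. The substitute is compatibility: it makes the relevant columns of the exchange matrix
  linearly independent, so some functional vanishes on one column and is positive on the other. Its
  grading isolates the lowest term of a binomial, a monomial, and a monomial can be divided out. The
  two sign choices \<open>pexp\<close> and \<open>nexp\<close> in the mutation matrix define the
  same form. This freedom makes mutation an involution and allows the sign to be adapted to the
  leading term in the two-direction argument.\<close>

lemma evalp_eq_sum:
  assumes "degree p \<le> n"
  shows "evalp p x = (\<Sum>i\<le>n. of_int (coeff p i) * x ^ i)"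
  unfolding evalp_def
  by (rule sum.mono_neutral_left) (use assms in \<open>auto simp: coeff_eq_0\<close>)

lemma evalp_0 [simp]: "evalp 0 x = 0"
  by (simp add: evalp_def)

lemma evalp_1 [simp]: "evalp 1 x = 1"
  by (simp add: evalp_def)

lemma evalp_add: "evalp (p + q) x = evalp p x + evalp q x"
proof -
  let ?n = "max (degree p) (degree q)"
  have "degree (p + q) \<le> ?n" by (simp add: degree_add_le_max)
  then show ?thesis
    using evalp_eq_sum[of p ?n x] evalp_eq_sum[of q ?n x] evalp_eq_sum[of "p + q" ?n x]
    by (simp add: sum.distrib algebra_simps)
qed

lemma evalp_smult: "evalp (smult a p) x = of_int a * evalp p x"
  using evalp_eq_sum[of "smult a p" "degree p" x] evalp_eq_sum[of p "degree p" x]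
  by (simp add: sum_distrib_left mult.assoc)

lemma evalp_pCons: "evalp (pCons a p) x = of_int a + x * evalp p x"
proof -
  have "evalp (pCons a p) x = (\<Sum>i\<le>Suc (degree p). of_int (coeff (pCons a p) i) * x ^ i)"
    by (rule evalp_eq_sum) (simp add: degree_pCons_le)
  also have "\<dots> = of_int a + (\<Sum>i\<le>degree p. of_int (coeff p i) * x ^ Suc i)"
    by (subst sum.atMost_Suc_shift) (simp del: power_Suc)
  also have "(\<Sum>i\<le>degree p. of_int (coeff p i) * x ^ Suc i) = x * evalp p x"
    by (simp add: evalp_def sum_distrib_left flip: mult.assoc)
      (simp add: mult_of_int_commute)
  finally show ?thesis .
qed

text \<open>Holds in a noncommutative ring because only integers and powers of the single element
  \<open>x\<close> are multiplied.\<close>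

lemma evalp_mult: "evalp (p * q) x = evalp p x * evalp q x"
  by (induction p) (auto simp: evalp_add evalp_smult evalp_pCons algebra_simps)

lemma evalp_minus: "evalp (- p) x = - evalp p x"
  using evalp_smult[of "-1" p x] by simp

lemma evalp_monom: "evalp (monom a n) x = of_int a * x ^ n"
proof (cases "a = 0")
  case False
  have "evalp (monom a n) x = (\<Sum>i\<le>n. of_int (coeff (monom a n) i) * x ^ i)"
    by (rule evalp_eq_sum) (simp add: degree_monom_le)
  also have "\<dots> = (\<Sum>i\<in>{n}. of_int (coeff (monom a n) i) * x ^ i)"
    by (rule sum.mono_neutral_right) auto
  finally show ?thesis by simp
qed simp

lemma evalp_sum: "evalp (sum p S) x = (\<Sum>i\<in>S. evalp (p i) x)"
  by (induction S rule: infinite_finite_induct) (auto simp: evalp_add)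

section \<open>Spans of toric frames\<close>

text \<open>Independence is stated for the values \<open>evalp (p f) h\<close>, since at a root of
  unity a nonzero polynomial can have value 0. The exponents of \<open>h\<close> are integers; if
  \<open>h\<close> has finite order, reducing them changes nothing.\<close>

definition toric_frame ::
  "'a::division_ring \<Rightarrow> (('n::finite \<Rightarrow> int) \<Rightarrow> 'a) \<Rightarrow> ('n \<Rightarrow> 'n \<Rightarrow> int) \<Rightarrow> bool" where
  "toric_frame h M L \<longleftrightarrow>
     (\<forall>f g. M f * M g = h powi (bil L f g) * M (f + g)) \<and>
     (\<forall>S p. finite S \<and> (\<Sum>f\<in>S. evalp (p f) h * M f) = 0 \<longrightarrow> (\<forall>f\<in>S. evalp (p f) h = 0)) \<and>
     generates_skew_field (insert h (range M))"

abbreviation coeffs :: "'a::division_ring \<Rightarrow> 'a set" where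
  "coeffs h \<equiv> subring_gen {h, inverse h}"

text \<open>The exponent set \<open>F\<close> carries the gradings: a homogeneous piece is the span
  over a level set. Exponents may repeat, which makes closure under sums immediate and leaves the
  merging of coefficients to \<open>lspan_sum_form\<close>.\<close>

inductive_set lspan :: "'a::division_ring \<Rightarrow> (('n \<Rightarrow> int) \<Rightarrow> 'a) \<Rightarrow> ('n \<Rightarrow> int) set \<Rightarrow> 'a set"
  for h M F where
  zero: "0 \<in> lspan h M F"
| step: "c \<in> coeffs h \<Longrightarrow> f \<in> F \<Longrightarrow> x \<in> lspan h M F \<Longrightarrow> c * M f + x \<in> lspan h M F"

lemma subring_gen_power: "x \<in> subring_gen G \<Longrightarrow> x ^ n \<in> subring_gen G"
  by (induction n) (auto intro: subring_gen.intros)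

lemma subring_gen_of_int: "of_int n \<in> subring_gen G"
proof -
  have *: "of_nat m \<in> subring_gen G" for m
    by (induction m) (auto intro: subring_gen.intros)
  show ?thesis
    by (cases n) (auto intro!: * subring_gen.neg simp del: of_nat_Suc)
qed

lemma coeffs_powi: "h powi n \<in> coeffs h"
  unfolding power_int_def by (simp add: subring_gen_power subring_gen.base)

lemma evalp_coeffs: "evalp p h \<in> coeffs h"
  by (induction p) (auto simp: evalp_pCons intro: subring_gen.intros subring_gen_of_int)

lemma lspan_mono: "x \<in> lspan h M F \<Longrightarrow> F \<subseteq> G \<Longrightarrow> x \<in> lspan h M G"
  by (induction rule: lspan.induct) (auto intro: lspan.intros)

lemma lspan_scaled: "c \<in> coeffs h \<Longrightarrow> f \<in> F \<Longrightarrow> c * M f \<in> lspan h M F"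
  using lspan.step[OF _ _ lspan.zero, where c = c and f = f] by fastforce

lemma lspan_gen: "f \<in> F \<Longrightarrow> M f \<in> lspan h M F"
  using lspan_scaled[OF subring_gen.one, where f = f] by fastforce

lemma lspan_add: "x \<in> lspan h M F \<Longrightarrow> y \<in> lspan h M F \<Longrightarrow> x + y \<in> lspan h M F"
  by (induction rule: lspan.induct) (auto intro: lspan.intros simp: add.assoc)

lemma lspan_coeff: "x \<in> lspan h M F \<Longrightarrow> c \<in> coeffs h \<Longrightarrow> c * x \<in> lspan h M F"
  by (induction rule: lspan.induct)
    (auto intro: lspan.intros subring_gen.mult simp: distrib_left simp flip: mult.assoc)

lemma lspan_neg: "x \<in> lspan h M F \<Longrightarrow> - x \<in> lspan h M F"
  using lspan_coeff[of x h M F "- 1"] by (auto intro: subring_gen.intros)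

lemma lspan_diff: "x \<in> lspan h M F \<Longrightarrow> y \<in> lspan h M F \<Longrightarrow> x - y \<in> lspan h M F"
  using lspan_add[OF _ lspan_neg, of x h M F y] by simp

lemma lspan_sum: "(\<And>i. i \<in> S \<Longrightarrow> x i \<in> lspan h M F) \<Longrightarrow> sum x S \<in> lspan h M F"
  by (induction S rule: infinite_finite_induct) (auto intro: lspan.zero lspan_add)

lemma lspan_split:
  assumes "x \<in> lspan h M F"
  obtains a b where "a \<in> lspan h M (F \<inter> G)" "b \<in> lspan h M (F - G)" "x = a + b"
proof -
  from assms have "\<exists>a\<in>lspan h M (F \<inter> G). \<exists>b\<in>lspan h M (F - G). x = a + b"
  proof (induction rule: lspan.induct)
    case zero
    then show ?case by (auto intro!: bexI[of _ 0] lspan.zero)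
  next
    case (step c f x)
    then obtain a b where ab: "a \<in> lspan h M (F \<inter> G)" "b \<in> lspan h M (F - G)" "x = a + b"
      by blast
    show ?case
    proof (cases "f \<in> G")
      case True
      with step ab show ?thesis
        by (intro bexI[of _ "c * M f + a"] bexI[of _ b]) (auto intro: lspan.step simp: add.assoc)
    next
      case False
      with step ab show ?thesis
        by (intro bexI[of _ a] bexI[of _ "c * M f + b"])
          (auto intro: lspan.step simp: add.left_commute)
    qed
  qed
  with that show thesis by blast
qed

lemma lspan_sum_form:
  assumes "x \<in> lspan h M F"
  obtains S c where "finite S" "S \<subseteq> F" "\<And>f. c f \<in> coeffs h" "x = (\<Sum>f\<in>S. c f * M f)"
proof -
  from assms have "\<exists>S c. finite S \<and> S \<subseteq> F \<and> (\<forall>f. c f \<in> coeffs h) \<and> x = (\<Sum>f\<in>S. c f * M f)"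
  proof (induction rule: lspan.induct)
    case zero
    show ?case by (rule exI[of _ "{}"], rule exI[of _ "\<lambda>_. 0"]) (auto intro: subring_gen.zero)
  next
    case (step c f x)
    then obtain S c' where S: "finite S" "S \<subseteq> F" "\<forall>f. c' f \<in> coeffs h"
      "x = (\<Sum>f\<in>S. c' f * M f)" by blast
    let ?c = "\<lambda>g. (if g = f then c else 0) + (if g \<in> S then c' g else 0)"
    have "(\<Sum>g\<in>insert f S. ?c g * M g) =
       (\<Sum>g\<in>insert f S. (if g = f then c * M g else 0)) + (\<Sum>g\<in>insert f S. (if g \<in> S then c' g * M g else 0))"
      by (simp add: sum.distrib[symmetric]) (rule sum.cong, auto simp: distrib_right)
    also have "(\<Sum>g\<in>insert f S. (if g \<in> S then c' g * M g else 0)) = x"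
      unfolding S(4) by (rule sum.mono_neutral_cong_right) (use S in auto)
    finally have "c * M f + x = (\<Sum>g\<in>insert f S. ?c g * M g)"
      using S(1) by simp
    with step S show ?case
      by (intro exI[of _ "insert f S"] exI[of _ ?c]) (auto intro: subring_gen.intros)
  qed
  with that show thesis by blast
qed

locale central_unit =
  fixes h :: "'a::division_ring"
  assumes h_central: "h * x = x * h" and h_nz [simp]: "h \<noteq> 0"
begin

lemma powi_add: "h powi (m + n) = h powi m * h powi n"
  by (simp add: power_int_add)

lemma coeffs_central: "c \<in> coeffs h \<Longrightarrow> c * x = x * c"
proof (induction arbitrary: x rule: subring_gen.induct)
  case (base c)
  have "inverse h * x = inverse h * (x * h) * inverse h" by (simp add: mult.assoc)
  also have "\<dots> = x * inverse h" by (simp add: mult.assoc[symmetric] h_central[symmetric])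
  finally show ?case using base h_central by auto
next
  case (mult a b)
  then show ?case by (metis mult.assoc)
qed (auto simp: algebra_simps)

lemma powi_central: "h powi n * x = x * h powi n"
  by (simp add: coeffs_central coeffs_powi)

lemma powi_left_commute: "x * (h powi n * y) = h powi n * (x * y)"
  by (metis mult.assoc powi_central)

lemma coeffs_eval:
  assumes "c \<in> coeffs h"
  obtains N p where "h ^ N * c = evalp p h"
proof -
  from assms have "\<exists>N p. h ^ N * c = evalp p h"
  proof (induction rule: subring_gen.induct)
    case (base x)
    then show ?case
    proof (elim insertE emptyE)
      assume "x = h"
      then show ?thesis by (intro exI[of _ 0] exI[of _ "[:0, 1:]"]) (simp add: evalp_pCons)
    next
      assume "x = inverse h"
      then show ?thesis by (intro exI[of _ 1] exI[of _ 1]) simp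
    qed
  next
    case zero
    show ?case by (intro exI[of _ 0]) simp
  next
    case one
    show ?case by (intro exI[of _ 0] exI[of _ 1]) simp
  next
    case (add x y)
    then obtain N p N' p' where *: "h ^ N * x = evalp p h" "h ^ N' * y = evalp p' h" by blast
    have "h ^ (N + N') * (x + y) = h ^ N' * (h ^ N * x) + h ^ N * (h ^ N' * y)"
      by (simp add: distrib_left mult.assoc[symmetric] power_add[symmetric] add.commute)
    also have "\<dots> = evalp (monom 1 N' * p + monom 1 N * p') h"
      by (simp add: * evalp_add evalp_mult evalp_monom)
    finally show ?case by blast
  next
    case (neg x)
    then show ?case by (metis evalp_minus mult_minus_right)
  next
    case (mult x y)
    then obtain N p N' p' where *: "h ^ N * x = evalp p h" "h ^ N' * y = evalp p' h" by blast
    have "h ^ (N + N') * (x * y) = (h ^ N * x) * (h ^ N' * y)"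
      using powi_left_commute[of x "int N'" y] by (simp add: power_add mult.assoc)
    also have "\<dots> = evalp (p * p') h" by (simp add: * evalp_mult)
    finally show ?case by blast
  qed
  with that show thesis by blast
qed

lemma lspan_powi: "x \<in> lspan h M F \<Longrightarrow> h powi n * x \<in> lspan h M F"
  by (rule lspan_coeff) (auto simp: coeffs_powi)

lemma lspan_powi_gen: "f \<in> F \<Longrightarrow> h powi n * M f \<in> lspan h M F"
  by (rule lspan_scaled) (auto simp: coeffs_powi)

context
  fixes M :: "('n::finite \<Rightarrow> int) \<Rightarrow> 'a" and L
  assumes frame: "toric_frame h M L"
begin

lemma frame_mult: "M f * M g = h powi (bil L f g) * M (f + g)"
  using frame by (simp add: toric_frame_def)

lemma frame_add: "M (f + g) = h powi (- bil L f g) * (M f * M g)"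
  by (simp add: frame_mult power_int_minus mult.assoc[symmetric])

lemma frame_poly_indep:
  "finite S \<Longrightarrow> (\<Sum>f\<in>S. evalp (p f) h * M f) = 0 \<Longrightarrow> f \<in> S \<Longrightarrow> evalp (p f) h = 0"
  using frame unfolding toric_frame_def by blast

lemma frame_indep:
  assumes "finite S" "\<And>f. c f \<in> coeffs h" "(\<Sum>f\<in>S. c f * M f) = 0" "f \<in> S"
  shows "c f = 0"
proof -
  have "\<exists>N p. h ^ N * c g = evalp p h" for g
    using assms(2)[of g] coeffs_eval by metis
  then obtain N p where Np: "\<And>g. h ^ N g * c g = evalp (p g) h" by metis
  \<comment> \<open>One power of \<open>h\<close> that clears the denominators of all coefficients,
    since independence of a frame speaks of polynomials in \<open>h\<close> only.\<close>
  define K where "K = sum N S"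
  have le: "N g \<le> K" if "g \<in> S" for g
    unfolding K_def using that assms(1) by (simp add: member_le_sum)
  define q where "q g = monom 1 (K - N g) * p g" for g
  have q: "evalp (q g) h = h ^ K * c g" if "g \<in> S" for g
    using le[OF that]
    by (simp add: q_def evalp_mult evalp_monom Np[symmetric] mult.assoc[symmetric] power_add[symmetric])
  have "(\<Sum>g\<in>S. evalp (q g) h * M g) = h ^ K * (\<Sum>g\<in>S. c g * M g)"
    by (simp add: q sum_distrib_left mult.assoc)
  then have "evalp (q f) h = 0"
    using frame_poly_indep[of S q f] assms by simp
  with q[OF assms(4)] show ?thesis by simp
qed

lemma frame_nz [simp]: "M f \<noteq> 0"
  using frame_indep[of "{f}" "\<lambda>_. 1" f] by (auto intro: subring_gen.one)

lemma frame_zero [simp]: "M 0 = 1"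
proof -
  have "M 0 * M 0 = M 0" using frame_mult[of 0 0] by (simp add: bil_def)
  then show ?thesis by simp
qed

text \<open>Subtracting two expansions with disjoint supports gives a relation in which no terms
  merge, so independence kills every coefficient. Graded pieces are always compared in this
  way.\<close>

lemma lspan_disjoint:
  assumes "x \<in> lspan h M F" "x \<in> lspan h M G" "F \<inter> G = {}"
  shows "x = 0"
proof -
  obtain S c where S: "finite S" "S \<subseteq> F" "\<And>f. c f \<in> coeffs h" "x = (\<Sum>f\<in>S. c f * M f)"
    using lspan_sum_form[OF assms(1)] by blast
  obtain T e where T: "finite T" "T \<subseteq> G" "\<And>f. e f \<in> coeffs h" "x = (\<Sum>f\<in>T. e f * M f)"
    using lspan_sum_form[OF assms(2)] by blast
  have disj: "S \<inter> T = {}" using S T assms(3) by blast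
  let ?c = "\<lambda>f. if f \<in> S then c f else - e f"
  have "(\<Sum>f\<in>S \<union> T. ?c f * M f) = (\<Sum>f\<in>S. ?c f * M f) + (\<Sum>f\<in>T. ?c f * M f)"
    by (rule sum.union_disjoint) (use S T disj in auto)
  also have "(\<Sum>f\<in>S. ?c f * M f) = x" unfolding S(4) by (rule sum.cong) auto
  also have "(\<Sum>f\<in>T. ?c f * M f) = (\<Sum>f\<in>T. - (e f * M f))"
    by (rule sum.cong) (use disj in auto)
  also have "\<dots> = - x" by (simp add: T(4) sum_negf)
  finally have "(\<Sum>f\<in>S \<union> T. ?c f * M f) = 0" by simp
  moreover have "?c f \<in> coeffs h" for f
    using S(3) T(3) by (simp add: subring_gen.neg)
  ultimately have "?c f = 0" if "f \<in> S \<union> T" for f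
    using frame_indep[of "S \<union> T" ?c f] S(1) T(1) that by blast
  then show ?thesis unfolding S(4) by (intro sum.neutral) force
qed

lemma lspan_mult:
  assumes "x \<in> lspan h M F" "y \<in> lspan h M G" "\<And>f g. f \<in> F \<Longrightarrow> g \<in> G \<Longrightarrow> f + g \<in> H"
  shows "x * y \<in> lspan h M H"
  using assms(1)
proof (induction rule: lspan.induct)
  case zero
  show ?case by (simp add: lspan.zero)
next
  case (step c f x)
  have "M f * y \<in> lspan h M H"
    using assms(2)
  proof (induction rule: lspan.induct)
    case zero
    show ?case by (simp add: lspan.zero)
  next
    case (step e g y)
    have "M f * (e * M g) = e * (h powi (bil L f g) * M (f + g))"
      by (metis coeffs_central[OF step(1)] frame_mult mult.assoc)
    moreover have "e * (h powi (bil L f g) * M (f + g)) \<in> lspan h M H"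
      by (intro lspan_coeff lspan_powi_gen assms(3) step \<open>f \<in> F\<close>)
    ultimately show ?case
      using step by (simp add: distrib_left lspan_add)
  qed
  with step show ?case
    by (simp add: distrib_right mult.assoc lspan_add lspan_coeff)
qed

lemma lspan_UNIV_mult: "x \<in> lspan h M UNIV \<Longrightarrow> y \<in> lspan h M UNIV \<Longrightarrow> x * y \<in> lspan h M UNIV"
  by (rule lspan_mult) auto

lemma lspan_UNIV_one: "1 \<in> lspan h M UNIV"
  using lspan_gen[of 0 UNIV M h] by simp

lemma lspan_UNIV_power: "x \<in> lspan h M UNIV \<Longrightarrow> x ^ n \<in> lspan h M UNIV"
  by (induction n) (auto simp: lspan_UNIV_one lspan_UNIV_mult)

end

end

section \<open>Compatible pairs and their mutation\<close>

text \<open>Walking from \<open>f\<close> to 0 in unit steps never changes the sign of a coordinate,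
  so \<open>- unitv i\<close> has to be treated only where \<open>f\<close> is negative. Variables
  with nonnegative exponent are thus never inverted.\<close>

lemma vec_induct:
  fixes f :: "'n::finite \<Rightarrow> int"
  assumes "P 0" "\<And>f g. P f \<Longrightarrow> P g \<Longrightarrow> P (f + g)"
    and "\<And>i. 0 < f i \<Longrightarrow> P (unitv i)" "\<And>i. f i < 0 \<Longrightarrow> P (- unitv i)"
  shows "P f"
  using assms(3,4)
proof (induction "\<Sum>i\<in>UNIV. nat \<bar>f i\<bar>" arbitrary: f rule: less_induct)
  case less
  show ?case
  proof (cases "f = 0")
    case True
    then show ?thesis using assms(1) by simp
  next
    case False
    then obtain i where i: "f i \<noteq> 0" by (auto simp: fun_eq_iff)
    define e where "e = (if 0 < f i then unitv i else - unitv i :: 'n \<Rightarrow> int)"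
    have "P e" using i less.prems by (auto simp: e_def)
    have e_le: "\<bar>(f - e) j\<bar> \<le> \<bar>f j\<bar>" for j
      using i by (auto simp: e_def unitv_def)
    have sum_less: "(\<Sum>j\<in>UNIV. nat \<bar>(f - e) j\<bar>) < (\<Sum>j\<in>UNIV. nat \<bar>f j\<bar>)"
    proof (rule sum_strict_mono_ex1)
      show "\<forall>j\<in>UNIV. nat \<bar>(f - e) j\<bar> \<le> nat \<bar>f j\<bar>"
        by (intro ballI nat_mono e_le)
      show "\<exists>j\<in>UNIV. nat \<bar>(f - e) j\<bar> < nat \<bar>f j\<bar>"
        using i by (intro bexI[of _ i]) (auto simp: e_def unitv_def)
    qed simp
    have "P (f - e)"
    proof (rule less.hyps[OF sum_less])
      fix j
      show "P (unitv j)" if "0 < (f - e) j"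
        using that i by (intro less.prems(1)) (auto simp: e_def unitv_def split: if_splits)
      show "P (- unitv j)" if "(f - e) j < 0"
        using that i by (intro less.prems(2)) (auto simp: e_def unitv_def split: if_splits)
    qed
    from assms(2)[OF this \<open>P e\<close>] show ?thesis by simp
  qed
qed

lemma bil_add_left: "bil L (f + f') g = bil L f g + bil L f' g"
  by (simp add: bil_def algebra_simps sum.distrib)

lemma bil_add_right: "bil L f (g + g') = bil L f g + bil L f g'"
  by (simp add: bil_def algebra_simps sum.distrib)

lemma bil_scale_left: "bil L (\<lambda>i. c * f i) g = c * bil L f g"
  by (simp add: bil_def sum_distrib_left mult.assoc)

lemma bil_scale_right: "bil L f (\<lambda>i. c * g i) = c * bil L f g"
  by (simp add: bil_def sum_distrib_left mult.left_commute)

lemma bil_uminus_left: "bil L (- f) g = - bil L f g"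
  using bil_scale_left[of L "-1" f g] by (simp add: fun_Compl_def)

lemma bil_uminus_right: "bil L f (- g) = - bil L f g"
  using bil_scale_right[of L f "-1" g] by (simp add: fun_Compl_def)

lemma bil_diff_left: "bil L (f - f') g = bil L f g - bil L f' g"
  using bil_add_left[of L "f - f'" f' g] by simp

lemma bil_diff_right: "bil L f (g - g') = bil L f g - bil L f g'"
  using bil_add_right[of L f "g - g'" g'] by simp

lemma bil_zero [simp]: "bil L 0 g = 0" "bil L f 0 = 0"
  by (simp_all add: bil_def)

lemmas bil_simps = bil_add_left bil_add_right bil_scale_left bil_scale_right bil_uminus_left
  bil_uminus_right bil_diff_left bil_diff_right

lemma sum_unitv:
  fixes F :: "'n::finite \<Rightarrow> int"
  shows "(\<Sum>j\<in>UNIV. F j * unitv a j) = F a"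
proof -
  have "F j * unitv a j = (if j = a then F j else 0)" for j by (simp add: unitv_def)
  then show ?thesis by simp
qed

lemma bil_unitv_right: "bil L f (unitv a) = (\<Sum>i\<in>UNIV. f i * L i a)"
  by (simp add: bil_def sum_unitv)

lemma bil_unitv: "bil L (unitv i) (unitv j) = L i j"
  using sum_unitv[of "\<lambda>a. L a j" i] by (simp add: bil_unitv_right mult.commute)

text \<open>The linear map that sends \<open>unitv k\<close> to \<open>u\<close> and fixes the other
  unit vectors; an involution if \<open>u k = -1\<close>. For \<open>u = nexp k B\<close> it is the
  action of \<open>mutE k B\<close> when \<open>B k k = 0\<close>, and \<open>pexp k B\<close> gives
  the opposite sign choice.\<close>

definition tr :: "'n \<Rightarrow> ('n \<Rightarrow> int) \<Rightarrow> ('n \<Rightarrow> int) \<Rightarrow> 'n \<Rightarrow> int" where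
  "tr k u f = (f - (\<lambda>i. f k * unitv k i)) + (\<lambda>i. f k * u i)"

definition pexp :: "'n \<Rightarrow> ('n \<Rightarrow> 'n \<Rightarrow> int) \<Rightarrow> 'n \<Rightarrow> int" where
  "pexp k B = (\<lambda>i. - unitv k i + max 0 (B i k))"

definition nexp :: "'n \<Rightarrow> ('n \<Rightarrow> 'n \<Rightarrow> int) \<Rightarrow> 'n \<Rightarrow> int" where
  "nexp k B = (\<lambda>i. - unitv k i - min 0 (B i k))"

abbreviation (input) col :: "('n \<Rightarrow> 'n \<Rightarrow> int) \<Rightarrow> 'n \<Rightarrow> 'n \<Rightarrow> int" where
  "col B j \<equiv> \<lambda>i. B i j"

lemma unitv_same [simp]: "unitv k k = 1"
  and unitv_other: "i \<noteq> k \<Longrightarrow> unitv k i = 0"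
  by (simp_all add: unitv_def)

lemma tr_add: "tr k u (f + g) = tr k u f + tr k u g"
  by (simp add: tr_def fun_eq_iff algebra_simps)

lemma tr_at: "u k = -1 \<Longrightarrow> tr k u f k = - f k"
  by (simp add: tr_def)

lemma tr_fixed: "f k = 0 \<Longrightarrow> tr k u f = f"
  by (simp add: tr_def fun_eq_iff)

lemma tr_unitv: "tr k u (unitv k) = u"
  by (simp add: tr_def fun_eq_iff)

lemma tr_tr: "u k = -1 \<Longrightarrow> tr k u (tr k u f) = f"
  by (simp add: tr_def fun_eq_iff)

lemma pexp_eq: "pexp k B = nexp k B + col B k"
  by (auto simp: pexp_def nexp_def fun_eq_iff max_def min_def)

lemma bil_mutL_aux:
  "bil (mutL k B L) f g =
    bil L (\<lambda>i. \<Sum>a\<in>UNIV. mutE k B i a * f a) (\<lambda>i. \<Sum>a\<in>UNIV. mutE k B i a * g a)"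
proof -
  have "bil (mutL k B L) f g =
      (\<Sum>a\<in>UNIV. \<Sum>b\<in>UNIV. \<Sum>i\<in>UNIV. \<Sum>j\<in>UNIV. mutE k B i a * f a * L i j * (mutE k B j b * g b))"
    by (simp add: bil_def mutL_def sum_distrib_left sum_distrib_right mult_ac)
  also have "\<dots> = (\<Sum>a\<in>UNIV. \<Sum>i\<in>UNIV. \<Sum>b\<in>UNIV. \<Sum>j\<in>UNIV. mutE k B i a * f a * L i j * (mutE k B j b * g b))"
    by (rule sum.cong[OF refl], rule sum.swap)
  also have "\<dots> = (\<Sum>i\<in>UNIV. \<Sum>a\<in>UNIV. \<Sum>b\<in>UNIV. \<Sum>j\<in>UNIV. mutE k B i a * f a * L i j * (mutE k B j b * g b))"
    by (rule sum.swap)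
  also have "\<dots> = (\<Sum>i\<in>UNIV. \<Sum>a\<in>UNIV. \<Sum>j\<in>UNIV. \<Sum>b\<in>UNIV. mutE k B i a * f a * L i j * (mutE k B j b * g b))"
    by (rule sum.cong[OF refl], rule sum.cong[OF refl], rule sum.swap)
  also have "\<dots> = (\<Sum>i\<in>UNIV. \<Sum>j\<in>UNIV. \<Sum>a\<in>UNIV. \<Sum>b\<in>UNIV. mutE k B i a * f a * L i j * (mutE k B j b * g b))"
    by (rule sum.cong[OF refl], rule sum.swap)
  also have "\<dots> = (\<Sum>i\<in>UNIV. \<Sum>j\<in>UNIV. \<Sum>b\<in>UNIV. \<Sum>a\<in>UNIV. mutE k B i a * f a * L i j * (mutE k B j b * g b))"
    by (rule sum.cong[OF refl], rule sum.cong[OF refl], rule sum.swap)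
  also have "\<dots> = bil L (\<lambda>i. \<Sum>a\<in>UNIV. mutE k B i a * f a) (\<lambda>i. \<Sum>a\<in>UNIV. mutE k B i a * g a)"
    by (simp add: bil_def sum_distrib_left sum_distrib_right)
  finally show ?thesis .
qed

lemma mutE_tr:
  fixes f :: "'n::finite \<Rightarrow> int"
  assumes "B k k = 0"
  shows "(\<lambda>i. \<Sum>a\<in>UNIV. mutE k B i a * f a) = tr k (nexp k B) f"
proof
  fix i
  have "(\<Sum>a\<in>UNIV. mutE k B i a * f a) =
      (\<Sum>a\<in>UNIV. (if i = a then (if i = k then 0 else f a) else 0) + (if a = k then nexp k B i * f a else 0))"
    by (rule sum.cong) (use assms in \<open>auto simp: mutE_def nexp_def unitv_def max_def min_def\<close>)
  also have "\<dots> = tr k (nexp k B) f i"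
    by (auto simp: sum.distrib tr_def unitv_def)
  finally show "(\<Sum>a\<in>UNIV. mutE k B i a * f a) = tr k (nexp k B) f i" .
qed

text \<open>The numerator is even for all signs of \<open>a\<close> and \<open>b\<close>, so
  \<open>div 2\<close> is exact.\<close>

lemma mut_entry_eq:
  fixes a b :: int
  shows "(\<bar>a\<bar> * b + a * \<bar>b\<bar>) div 2 = a * max 0 b + max 0 (- a) * b"
proof -
  have "\<bar>a\<bar> * b + a * \<bar>b\<bar> = 2 * (a * max 0 b + max 0 (- a) * b)"
    by (auto simp: max_def abs_if)
  then show ?thesis by simp
qed

lemma mutB_eq:
  "mutB k B i j = (if i = k \<or> j = k then - B i j
     else B i j + (B i k * max 0 (B k j) + max 0 (- B i k) * B k j))"
  by (simp add: mutB_def mut_entry_eq)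

lemma mutB_mutB: "mutB k (mutB k B) = B"
  by (auto simp: mutB_eq fun_eq_iff max_def algebra_simps)

locale compatible_pair =
  fixes ex :: "'n::finite set" and d :: "'n \<Rightarrow> int" and B L :: "'n \<Rightarrow> 'n \<Rightarrow> int"
  assumes skew: "L i j = - L j i"
    and d_pos: "j \<in> ex \<Longrightarrow> 0 < d j"
    and compatible: "j \<in> ex \<Longrightarrow> (\<Sum>k\<in>UNIV. B k j * L k i) = (if i = j then d j else 0)"
begin

lemma bil_skew: "bil L f g = - bil L g f"
proof -
  have "f i * L i j * g j = - (g j * L j i * f i)" for i j
    by (subst skew) simp
  then have "bil L f g = (\<Sum>i\<in>UNIV. \<Sum>j\<in>UNIV. - (g j * L j i * f i))"
    by (simp add: bil_def)
  also have "\<dots> = - bil L g f"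
    unfolding bil_def by (subst sum.swap) (simp add: sum_negf)
  finally show ?thesis .
qed

lemma bil_self [simp]: "bil L f f = 0"
  using bil_skew[of f f] by simp

lemma bil_col: "j \<in> ex \<Longrightarrow> bil L (col B j) f = d j * f j"
proof -
  assume j: "j \<in> ex"
  have "bil L (col B j) f = (\<Sum>a\<in>UNIV. (\<Sum>i\<in>UNIV. B i j * L i a) * f a)"
    unfolding bil_def by (subst sum.swap) (simp add: sum_distrib_right)
  also have "\<dots> = (\<Sum>a\<in>UNIV. if a = j then d j * f a else 0)"
    by (rule sum.cong) (auto simp: compatible[OF j])
  finally show ?thesis by simp
qed

lemma bil_col_right: "j \<in> ex \<Longrightarrow> bil L f (col B j) = - (d j * f j)"
  using bil_skew[of f "col B j"] bil_col by simp

text \<open>Pairing columns \<open>i\<close> and \<open>j\<close> by \<open>bil_col\<close> and by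
  \<open>bil_col_right\<close> computes the same number twice.\<close>

lemma DB_skew: "i \<in> ex \<Longrightarrow> j \<in> ex \<Longrightarrow> d i * B i j = - (d j * B j i)"
  using bil_col[of i "col B j"] bil_col_right[of j "col B i"] by simp

lemma B_diag: "j \<in> ex \<Longrightarrow> B j j = 0"
  using DB_skew[of j j] d_pos[of j] by simp

lemma pexp_k: "k \<in> ex \<Longrightarrow> pexp k B k = -1"
  and nexp_k: "k \<in> ex \<Longrightarrow> nexp k B k = -1"
  by (simp_all add: pexp_def nexp_def B_diag)

lemma bil_mutL_n: "k \<in> ex \<Longrightarrow> bil (mutL k B L) f g = bil L (tr k (nexp k B) f) (tr k (nexp k B) g)"
  by (simp add: bil_mutL_aux mutE_tr B_diag)

lemma tr_pexp: "tr k (pexp k B) f = tr k (nexp k B) f + (\<lambda>i. f k * B i k)"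
  by (simp add: tr_def pexp_eq fun_eq_iff algebra_simps)

text \<open>Passing from \<open>nexp k B\<close> to \<open>pexp k B\<close> adds \<open>f k\<close>
  times column \<open>k\<close>; by compatibility the two cross terms are
  \<open>d k * f k * g k\<close> with opposite signs and cancel.\<close>

lemma bil_mutL_p:
  assumes k: "k \<in> ex"
  shows "bil (mutL k B L) f g = bil L (tr k (pexp k B) f) (tr k (pexp k B) g)"
  using k by (simp add: bil_mutL_n tr_pexp bil_simps bil_col bil_col_right tr_at nexp_k B_diag)

lemma tr_nexp_col_mutB:
  assumes k: "k \<in> ex" and "j \<noteq> k"
  shows "tr k (nexp k B) (col (mutB k B) j) = col B j + (\<lambda>i. max 0 (B k j) * B i k)"
proof
  fix i
  show "tr k (nexp k B) (col (mutB k B) j) i = (col B j + (\<lambda>i. max 0 (B k j) * B i k)) i"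
    using assms by (cases "i = k")
      (auto simp: tr_def mutB_eq nexp_def unitv_def B_diag max_def min_def algebra_simps)
qed

lemma mutated_compatible:
  assumes k: "k \<in> ex"
  shows "compatible_pair ex d (mutB k B) (mutL k B L)"
proof
  show "mutL k B L i j = - mutL k B L j i" for i j
    using bil_skew by (metis bil_mutL_n bil_unitv k)
  show "0 < d j" if "j \<in> ex" for j using d_pos that .
  show "(\<Sum>a\<in>UNIV. mutB k B a j * mutL k B L a i) = (if i = j then d j else 0)" if j: "j \<in> ex" for i j
  proof -
    have "(\<Sum>a\<in>UNIV. mutB k B a j * mutL k B L a i) = bil (mutL k B L) (col (mutB k B) j) (unitv i)"
      by (simp add: bil_unitv_right)
    also have "\<dots> = (if i = j then d j else 0)"
    proof (cases "j = k")
      case True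
      have "col (mutB k B) k = - col B k" by (auto simp: mutB_def fun_eq_iff)
      then show ?thesis using True k
        by (simp add: bil_mutL_n tr_fixed B_diag bil_simps bil_col tr_at nexp_k unitv_def)
    next
      case False
      \<comment> \<open>Settles the case \<open>i = k\<close>: the entry of \<open>nexp k B\<close>
        at \<open>j\<close> contributes the left side, and its entry \<open>-1\<close> at
        \<open>k\<close> subtracts the right side.\<close>
      have "d j * max 0 (- B j k) = max 0 (B k j) * d k"
        using DB_skew[OF j k] d_pos[OF j] d_pos[OF k]
          max_mult_distrib_left[of "d j" 0 "- B j k"] max_mult_distrib_right[of 0 "B k j" "d k"]
        by (simp add: mult.commute)
      then show ?thesis using False k j
        by (auto simp: bil_mutL_n tr_nexp_col_mutB bil_simps bil_col tr_at nexp_k)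
          (auto simp: tr_def unitv_def nexp_def max_def min_def split: if_splits)
    qed
    finally show ?thesis .
  qed
qed

lemma pexp_mutB: "pexp k (mutB k B) = nexp k B"
  and nexp_mutB: "nexp k (mutB k B) = pexp k B"
  by (auto simp: pexp_def nexp_def mutB_def max_def min_def fun_eq_iff)

text \<open>The second mutation uses \<open>nexp k (mutB k B) = pexp k B\<close>, so the first one
  is rewritten with the opposite sign before the involution \<open>tr_tr\<close> applies.\<close>

lemma mutL_mutL:
  assumes k: "k \<in> ex"
  shows "mutL k (mutB k B) (mutL k B L) = L"
proof (intro ext)
  fix i j
  interpret mut: compatible_pair ex d "mutB k B" "mutL k B L"
    by (rule mutated_compatible[OF k])
  show "mutL k (mutB k B) (mutL k B L) i j = L i j"
    using k mut.bil_mutL_n[OF k, of "unitv i" "unitv j"]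
    by (simp add: nexp_mutB bil_mutL_p tr_tr pexp_k bil_unitv)
qed

end

definition mut_at :: "'a::division_ring \<Rightarrow> 'n::finite \<Rightarrow> (('n \<Rightarrow> int) \<Rightarrow> 'a) \<Rightarrow> ('n \<Rightarrow> 'n \<Rightarrow> int) \<Rightarrow>
    ('n \<Rightarrow> 'n \<Rightarrow> int) \<Rightarrow> (('n \<Rightarrow> int) \<Rightarrow> 'a) \<Rightarrow> bool" where
  "mut_at h k M B L M' \<longleftrightarrow> toric_frame h M' (mutL k B L) \<and>
     (\<forall>j. j \<noteq> k \<longrightarrow> M' (unitv j) = M (unitv j)) \<and>
     M' (unitv k) = M (pexp k B) + M (nexp k B)"

lemma mut_step_iff:
  "mut_step ex (toric_frame h) (M, B, L) s \<longleftrightarrow>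
     (\<exists>k\<in>ex. \<exists>M'. s = (M', mutB k B, mutL k B L) \<and> mut_at h k M B L M')"
  by (cases s) (auto simp: mut_step_def mut_at_def pexp_def nexp_def)

locale seed = central_unit h + compatible_pair ex d B L
  for h :: "'a::division_ring" and ex :: "'n::finite set" and d B L +
  fixes M :: "('n \<Rightarrow> int) \<Rightarrow> 'a"
  assumes frame: "toric_frame h M L"
begin

lemmas M_mult = frame_mult[OF frame]
  and M_add = frame_add[OF frame]
  and M_nz [simp] = frame_nz[OF frame]
  and M_zero [simp] = frame_zero[OF frame]

lemma M_neg: "M (- f) = inverse (M f)"
proof -
  have "M f * M (- f) = 1" by (simp add: M_mult bil_simps)
  then show ?thesis by (simp add: inverse_unique)
qed

lemma mutated_seed: "k \<in> ex \<Longrightarrow> mut_at h k M B L M' \<Longrightarrow> seed h ex d (mutB k B) (mutL k B L) M'"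
  using mutated_compatible[of k] central_unit_axioms
  by (auto simp: seed_def seed_axioms_def mut_at_def)

text \<open>On the hyperplane \<open>f k = 0\<close> the mutated form equals the old one, so both
  frames normalize the same products of variables in the same way.\<close>

lemma mut_agree:
  assumes k: "k \<in> ex" and mut: "mut_at h k M B L M'" and f: "f k = 0"
  shows "M' f = M f"
proof -
  interpret mut: seed h ex d "mutB k B" "mutL k B L" M'
    by (rule mutated_seed[OF k mut])
  have agree: "M' (unitv j) = M (unitv j)" if "j \<noteq> k" for j
    using mut that by (simp add: mut_at_def)
  have "f k = 0 \<and> M' f = M f"
  proof (rule vec_induct[where P = "\<lambda>f. f k = 0 \<and> M' f = M f"])
    show "(f + g) k = 0 \<and> M' (f + g) = M (f + g)"
      if "f k = 0 \<and> M' f = M f" "g k = 0 \<and> M' g = M g" for f g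
      using that k by (simp add: M_add mut.M_add bil_mutL_n tr_fixed)
    show "unitv i k = 0 \<and> M' (unitv i) = M (unitv i)" if "0 < f i" for i
      using that f agree[of i] by (cases "i = k") (auto simp: unitv_def)
    show "(- unitv i) k = 0 \<and> M' (- unitv i) = M (- unitv i)" if "f i < 0" for i
      using that f agree[of i] by (cases "i = k") (auto simp: unitv_other M_neg mut.M_neg)
  qed simp
  then show ?thesis by simp
qed

lemma mut_reverse:
  assumes k: "k \<in> ex" and mut: "mut_at h k M B L M'"
  shows "mut_at h k M' (mutB k B) (mutL k B L) M"
proof -
  interpret mut: seed h ex d "mutB k B" "mutL k B L" M'
    by (rule mutated_seed[OF k mut])
  let ?p = "pexp k B" and ?n = "nexp k B" and ?L' = "mutL k B L"
  have X: "M' (unitv k) = M ?p + M ?n" using mut by (simp add: mut_at_def)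
  have tr_u: "tr k u u = unitv k" if "u k = -1" for u :: "'n \<Rightarrow> int"
    using tr_tr[of u k "unitv k"] that by (simp add: tr_unitv)
  \<comment> \<open>After multiplication by \<open>M' (unitv k)\<close> only monomials with exponent
    0 at \<open>k\<close> remain, where the frames agree. The map \<open>tr\<close> exchanges
    \<open>unitv k\<close> with \<open>?p\<close> or \<open>?n\<close>, which swaps the arguments of
    the form and matches the opposite order of the factors.\<close>
  have "M' (unitv k) * (M' ?p + M' ?n) = M' (unitv k) * M (unitv k)"
  proof -
    have "M' (unitv k + u) = M (unitv k + u)" if "u k = -1" for u
      by (rule mut_agree[OF k mut]) (simp add: that)
    then have "M' (unitv k) * (M' ?p + M' ?n) =
       h powi (bil ?L' (unitv k) ?p) * M (unitv k + ?p) + h powi (bil ?L' (unitv k) ?n) * M (unitv k + ?n)"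
      using k by (simp add: distrib_left mut.M_mult pexp_k nexp_k)
    also have "bil ?L' (unitv k) ?p = bil L ?p (unitv k)"
      using k by (simp add: bil_mutL_p tr_unitv tr_u pexp_k)
    also have "bil ?L' (unitv k) ?n = bil L ?n (unitv k)"
      using k by (simp add: bil_mutL_n tr_unitv tr_u nexp_k)
    also have "h powi (bil L ?p (unitv k)) * M (unitv k + ?p) + h powi (bil L ?n (unitv k)) * M (unitv k + ?n)
       = M' (unitv k) * M (unitv k)"
      by (simp add: X distrib_right M_mult add.commute[of "unitv k"])
    finally show ?thesis .
  qed
  then have "M (unitv k) = M' ?p + M' ?n" by simp
  then show ?thesis
    using mut frame k unfolding mut_at_def pexp_mutB nexp_mutB
    by (simp add: mutL_mutL add.commute)
qed

lemma mut_unique: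
  assumes k: "k \<in> ex" and mut: "mut_at h k M B L M'" and mut2: "mut_at h k M B L M''"
  shows "M' = M''"
proof
  fix f
  interpret mut: seed h ex d "mutB k B" "mutL k B L" M'
    by (rule mutated_seed[OF k mut])
  interpret mut2: seed h ex d "mutB k B" "mutL k B L" M''
    by (rule mutated_seed[OF k mut2])
  have *: "M' (unitv j) = M'' (unitv j)" for j
    using mut mut2 by (cases "j = k") (auto simp: mut_at_def)
  show "M' f = M'' f"
    by (rule vec_induct[where P = "\<lambda>f. M' f = M'' f"])
      (auto simp: mut.M_add mut2.M_add mut.M_neg mut2.M_neg *)
qed

end

section \<open>Existence of the mutated frame\<close>

context central_unit
begin

lemma powi_mult_mult: "(h powi s * x) * (h powi t * y) = h powi (s + t) * (x * y)"
  by (simp add: powi_add mult.assoc powi_left_commute[of x t y])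

lemma qcomm_power:
  assumes "x * y = h powi s * (y * x)"
  shows "x ^ m * y = h powi (int m * s) * (y * x ^ m)"
proof (induction m)
  case (Suc m)
  have "x ^ Suc m * y = x * (h powi (int m * s) * (y * x ^ m))"
    by (simp add: mult.assoc Suc)
  also have "\<dots> = h powi (int m * s) * ((x * y) * x ^ m)"
    by (metis powi_left_commute mult.assoc)
  also have "\<dots> = h powi (int m * s + s) * (y * (x * x ^ m))"
    by (simp only: assms powi_add mult.assoc)
  also have "\<dots> = h powi (int (Suc m) * s) * (y * x ^ Suc m)"
    by (simp add: algebra_simps)
  finally show ?case .
qed simp

lemma qcomm_powi:
  assumes "x * y = h powi s * (y * x)" and "x \<noteq> 0"
  shows "x powi m * y = h powi (m * s) * (y * x powi m)"
proof (cases "0 \<le> m")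
  case True
  then show ?thesis using qcomm_power[OF assms(1), of "nat m"] by (simp add: power_int_def)
next
  case False
  have "y * inverse x = inverse x * (x * y) * inverse x"
    using assms(2) by (simp add: mult.assoc[symmetric])
  also have "\<dots> = h powi s * (inverse x * y)"
    unfolding assms(1) using assms(2) by (simp add: powi_left_commute mult.assoc)
  finally have "inverse x * y = h powi (- s) * (y * inverse x)"
    by (simp add: power_int_minus mult.assoc[symmetric])
  from qcomm_power[OF this, of "nat (- m)"] False show ?thesis
    by (simp add: power_int_def)
qed

end

context seed
begin

lemma M_commute: "M f * M g = h powi (2 * bil L f g) * (M g * M f)"
proof -
  have "M f * M g = h powi (2 * bil L f g) * (h powi (bil L g f) * M (f + g))"
    using bil_skew[of g f] by (simp add: M_mult mult.assoc[symmetric] powi_add[symmetric])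
  then show ?thesis by (simp add: M_mult add.commute)
qed

definition newvar :: "'n \<Rightarrow> 'a" where
  "newvar k = M (pexp k B) + M (nexp k B)"

definition dropk :: "'n \<Rightarrow> ('n \<Rightarrow> int) \<Rightarrow> 'n \<Rightarrow> int" where
  "dropk k f = f - (\<lambda>i. f k * unitv k i)"

text \<open>The power of \<open>h\<close> is the Weyl normalization of the ordered product that follows it.\<close>

definition mframe :: "'n \<Rightarrow> ('n \<Rightarrow> int) \<Rightarrow> 'a" where
  "mframe k f = h powi (- (f k * bil L (dropk k f) (nexp k B))) * (M (dropk k f) * newvar k powi f k)"

lemma dropk_k [simp]: "dropk k f k = 0"
  by (simp add: dropk_def)

lemma dropk_add: "dropk k (f + g) = dropk k f + dropk k g"
  by (simp add: dropk_def fun_eq_iff algebra_simps)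

lemma dropk_fixed: "f k = 0 \<Longrightarrow> dropk k f = f"
  by (simp add: dropk_def fun_eq_iff)

lemma dropk_unitv: "dropk k (unitv k) = 0"
  by (simp add: dropk_def fun_eq_iff)

context
  fixes k assumes k: "k \<in> ex"
begin

lemma col_nz: "col B k \<noteq> 0"
proof
  assume "col B k = 0"
  then have "bil L (col B k) (unitv k) = 0" by simp
  with bil_col[OF k, of "unitv k"] d_pos[OF k] show False by simp
qed

lemma newvar_nz: "newvar k \<noteq> 0"
proof
  assume "newvar k = 0"
  moreover have "pexp k B \<noteq> nexp k B" using col_nz by (simp add: pexp_eq)
  ultimately have "(1 :: 'a) = 0"
    using frame_indep[OF frame, of "{pexp k B, nexp k B}" "\<lambda>_. 1" "nexp k B"]
    by (auto simp: newvar_def intro: subring_gen.one)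
  then show False by simp
qed

text \<open>The two exponents in \<open>newvar k\<close> differ by column \<open>k\<close>, which
  pairs to 0 with \<open>r\<close>; both terms pass \<open>M r\<close> with the same power of
  \<open>h\<close>, and hence so does their sum.\<close>

lemma newvar_powi_commute:
  assumes "r k = 0"
  shows "newvar k powi m * M r = h powi (2 * m * bil L (nexp k B) r) * (M r * newvar k powi m)"
proof -
  have "bil L (pexp k B) r = bil L (nexp k B) r"
    using assms by (simp add: pexp_eq bil_simps bil_col k)
  then have "newvar k * M r = h powi (2 * bil L (nexp k B) r) * (M r * newvar k)"
    unfolding newvar_def distrib_left distrib_right
    by (simp add: M_commute[of "pexp k B" r] M_commute[of "nexp k B" r])
  from qcomm_powi[OF this newvar_nz, of m] show ?thesis by (simp add: mult_ac)
qed

lemma mframe_mult: "mframe k f * mframe k g = h powi (bil (mutL k B L) f g) * mframe k (f + g)"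
proof -
  let ?n = "nexp k B" and ?f = "dropk k f" and ?g = "dropk k g" and ?X = "newvar k"
  let ?s = "- (f k * bil L ?f ?n)" and ?t = "- (g k * bil L ?g ?n)"
  have "mframe k f * mframe k g = h powi (?s + ?t) * (M ?f * ((?X powi f k * M ?g) * ?X powi g k))"
    unfolding mframe_def powi_mult_mult by (simp add: mult.assoc)
  also have "(?X powi f k * M ?g) * ?X powi g k = h powi (2 * f k * bil L ?n ?g) * (M ?g * ?X powi (f + g) k)"
    by (simp add: newvar_powi_commute power_int_add newvar_nz mult.assoc)
  also have "M ?f * \<dots> = h powi (2 * f k * bil L ?n ?g) * (M ?f * M ?g * ?X powi (f + g) k)"
    by (simp add: powi_left_commute[of "M ?f"] mult.assoc)
  also have "h powi (?s + ?t) * \<dots> = h powi (?s + (?t + (2 * f k * bil L ?n ?g + bil L ?f ?g))) *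
      (M (dropk k (f + g)) * ?X powi (f + g) k)"
    unfolding powi_add M_mult dropk_add mult.assoc ..
  also have "?s + (?t + (2 * f k * bil L ?n ?g + bil L ?f ?g)) =
      bil (mutL k B L) f g + - ((f + g) k * bil L (dropk k (f + g)) ?n)"
    unfolding bil_mutL_n[OF k] tr_def dropk_def[symmetric]
    using bil_skew[of ?n ?g] by (simp add: bil_simps dropk_add algebra_simps)
  also have "h powi \<dots> * (M (dropk k (f + g)) * ?X powi (f + g) k) =
      h powi (bil (mutL k B L) f g) * mframe k (f + g)"
    unfolding powi_add mframe_def mult.assoc ..
  finally show ?thesis .
qed

lemma mframe_fixed: "f k = 0 \<Longrightarrow> mframe k f = M f"
  by (simp add: mframe_def dropk_fixed)

lemma mframe_k: "mframe k (unitv k) = newvar k"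
  by (simp add: mframe_def dropk_unitv)

lemma newvar_power_lspan: "newvar k ^ m \<in> lspan h M {g. g k = - int m}"
proof (induction m)
  case 0
  show ?case using lspan_gen[of 0 "{g. g k = 0}" M h] by simp
next
  case (Suc m)
  have "newvar k \<in> lspan h M {g. g k = -1}"
    unfolding newvar_def by (intro lspan_add lspan_gen) (auto simp: pexp_k nexp_k k)
  from lspan_mult[OF frame this Suc, of "{g. g k = - int (Suc m)}"] show ?case by simp
qed

text \<open>Right multiplication by a power of \<open>newvar k\<close> removes its negative powers.
  Term \<open>f\<close> then has exponent \<open>- (f k + N)\<close> at \<open>k\<close> in the old
  frame, so different values of \<open>f k\<close> separate; within one value the common power
  cancels and independence of \<open>M\<close> applies.\<close>

lemma mframe_indep:
  assumes S: "finite S" "(\<Sum>f\<in>S. evalp (p f) h * mframe k f) = 0" "f0 \<in> S"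
  shows "evalp (p f0) h = 0"
proof -
  let ?X = "newvar k"
  define s where "s f = - (f k * bil L (dropk k f) (nexp k B))" for f
  define N where "N = (\<Sum>f\<in>S. nat \<bar>f k\<bar>)"
  define t where "t f = evalp (p f) h * mframe k f * ?X ^ N" for f
  define r where "r = f0 k"
  define S0 where "S0 = {f \<in> S. f k = r}"
  have t_lspan: "t f \<in> lspan h M {g. g k = - (f k + int N)}" if "f \<in> S" for f
  proof -
    have "nat \<bar>f k\<bar> \<le> N" unfolding N_def using S(1) that by (intro member_le_sum) auto
    then have "?X powi f k * ?X ^ N = ?X ^ nat (f k + int N)"
      using power_int_add[of ?X "f k" "int N"] power_int_nonneg_exp[of "f k + int N" ?X] newvar_nz
      by auto
    then have "t f = evalp (p f) h * (h powi s f * (M (dropk k f) * ?X ^ nat (f k + int N)))"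
      by (simp add: t_def mframe_def s_def mult.assoc)
    moreover have "M (dropk k f) * ?X ^ nat (f k + int N) \<in> lspan h M {g. g k = - (f k + int N)}"
      by (rule lspan_mult[OF frame lspan_gen[of _ "{g. g k = 0}"] newvar_power_lspan])
        (use \<open>nat \<bar>f k\<bar> \<le> N\<close> in auto)
    ultimately show ?thesis by (simp add: lspan_powi lspan_coeff evalp_coeffs)
  qed
  have "(\<Sum>f\<in>S. t f) = (\<Sum>f\<in>S. evalp (p f) h * mframe k f) * ?X ^ N"
    by (simp add: t_def sum_distrib_right)
  then have "(\<Sum>f\<in>S0. t f) + (\<Sum>f\<in>S - S0. t f) = 0"
    using S sum.subset_diff[of S0 S t] by (simp add: S0_def add.commute)
  then have eq: "(\<Sum>f\<in>S0. t f) = - (\<Sum>f\<in>S - S0. t f)" by (simp add: add_eq_0_iff2)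
  have "(\<Sum>f\<in>S0. t f) \<in> lspan h M {g. g k = - (r + int N)}"
    using t_lspan by (intro lspan_sum) (auto simp: S0_def)
  moreover have "- (\<Sum>f\<in>S - S0. t f) \<in> lspan h M {g. g k \<noteq> - (r + int N)}"
    by (intro lspan_neg lspan_sum lspan_mono[OF t_lspan]) (auto simp: S0_def)
  ultimately have "(\<Sum>f\<in>S0. t f) = 0"
    unfolding eq by (rule lspan_disjoint[OF frame]) auto
  moreover have "(\<Sum>f\<in>S0. t f) =
      (\<Sum>f\<in>S0. (evalp (p f) h * h powi s f) * M (dropk k f)) * (?X powi r * ?X ^ N)"
    unfolding sum_distrib_right t_def mframe_def s_def
    by (rule sum.cong) (auto simp: S0_def mult.assoc)
  ultimately have "(\<Sum>f\<in>S0. (evalp (p f) h * h powi s f) * M (dropk k f)) = 0"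
    using newvar_nz by simp
  \<comment> \<open>Forgetting coordinate \<open>k\<close> is injective on \<open>S0\<close>, where
    it has the constant value \<open>r\<close>; \<open>lift\<close> restores it.\<close>
  moreover define lift where "lift g = g + (\<lambda>i. r * unitv k i)" for g
  have lift: "lift (dropk k f) = f" if "f \<in> S0" for f
    using that by (auto simp: lift_def dropk_def S0_def)
  moreover have "(\<Sum>f\<in>S0. (evalp (p f) h * h powi s f) * M (dropk k f)) =
      (\<Sum>g\<in>dropk k ` S0. (evalp (p (lift g)) h * h powi s (lift g)) * M g)"
    by (subst sum.reindex) (auto intro!: inj_on_inverseI[of _ lift] simp: lift)
  ultimately have "(\<Sum>g\<in>dropk k ` S0. (evalp (p (lift g)) h * h powi s (lift g)) * M g) = 0"
    by simp
  from frame_indep[OF frame _ _ this, of "dropk k f0"]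
  have "evalp (p (lift (dropk k f0))) h * h powi s (lift (dropk k f0)) = 0"
    using S by (simp add: S0_def r_def subring_gen.mult evalp_coeffs coeffs_powi)
  moreover have "f0 \<in> S0" using S by (simp add: S0_def r_def)
  ultimately show ?thesis by (simp add: lift)
qed

lemma mframe_generates: "generates_skew_field (insert h (range (mframe k)))"
  unfolding generates_skew_field_def
proof (intro allI impI, elim conjE)
  fix T
  assume T: "0 \<in> T" "1 \<in> T" "\<forall>x\<in>T. \<forall>y\<in>T. x + y \<in> T \<and> x * y \<in> T"
    "\<forall>x\<in>T. - x \<in> T \<and> inverse x \<in> T" "insert h (range (mframe k)) \<subseteq> T"
  have pow: "x ^ m \<in> T" if "x \<in> T" for x m
    using T that by (induction m) auto
  have hT: "h powi m \<in> T" for m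
    using T pow[of h] pow[of "inverse h"] by (simp add: power_int_def)
  have fixed: "M f \<in> T" if "f k = 0" for f
    using T(5) mframe_fixed[of f] that by (metis insert_subset range_subsetD)
  have X: "newvar k \<in> T"
    using T(5) mframe_k by (metis insert_subset range_subsetD)
  \<comment> \<open>This product involves only exponents vanishing at \<open>k\<close>; dividing by
    \<open>newvar k\<close> then recovers the old variable.\<close>
  have "M (unitv k) * newvar k \<in> T"
    unfolding newvar_def distrib_left M_mult
    using T hT fixed[of "unitv k + pexp k B"] fixed[of "unitv k + nexp k B"]
    by (simp add: pexp_k nexp_k k)
  then have "(M (unitv k) * newvar k) * inverse (newvar k) \<in> T"
    using T X by blast
  then have Mk: "M (unitv k) \<in> T" using newvar_nz by (simp add: mult.assoc)
  have unitv: "M (unitv i) \<in> T" for i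
    using Mk fixed[of "unitv i"] by (cases "i = k") (auto simp: unitv_def)
  have "M f \<in> T" for f
    by (rule vec_induct[where P = "\<lambda>f. M f \<in> T"])
      (use T hT unitv in \<open>auto simp: M_neg M_add\<close>)
  then have "insert h (range M) \<subseteq> T" using T by auto
  with T frame show "T = UNIV"
    unfolding toric_frame_def generates_skew_field_def by blast
qed

lemma mframe_mut_at: "mut_at h k M B L (mframe k)"
  unfolding mut_at_def toric_frame_def
  using mframe_mult mframe_indep mframe_generates mframe_k mframe_fixed
  by (auto simp: newvar_def unitv_other)

end

lemma mut_exists: "k \<in> ex \<Longrightarrow> \<exists>M'. mut_at h k M B L M'"
  using mframe_mut_at by blast

end

section \<open>The quantum Laurent phenomenon\<close>

abbreviation torus :: "'a::division_ring \<Rightarrow> (('n \<Rightarrow> int) \<Rightarrow> 'a) \<Rightarrow> 'a set" where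
  "torus h M \<equiv> lspan h M UNIV"

lemma lspan_torus: "x \<in> lspan h M F \<Longrightarrow> x \<in> torus h M"
  by (erule lspan_mono) simp

context seed
begin

lemmas torus_mult = lspan_UNIV_mult[OF frame]
  and torus_one = lspan_UNIV_one[OF frame]
  and torus_power = lspan_UNIV_power[OF frame]
  and span_mult = lspan_mult[OF frame]
  and span_disjoint = lspan_disjoint[OF frame]

lemma torus_coeffs: "c \<in> coeffs h \<Longrightarrow> c \<in> torus h M"
  using lspan_coeff[OF torus_one] by force

lemma M_torus: "M f \<in> torus h M"
  by (rule lspan_gen) simp

end

section \<open>Two tori related by one mutation\<close>

locale seed_mutation = seed h ex d B L M
  for h :: "'a::division_ring" and ex :: "'n::finite set" and d B L M +
  fixes j M'
  assumes j: "j \<in> ex" and mut: "mut_at h j M B L M'"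
begin

sublocale mut: seed h ex d "mutB j B" "mutL j B L" M'
  by (rule mutated_seed[OF j mut])

lemma reverse: "seed_mutation h ex d (mutB j B) (mutL j B L) M' j M"
  by unfold_locales (rule j mut_reverse[OF j mut])+

lemma agree: "f j = 0 \<Longrightarrow> M' f = M f"
  by (rule mut_agree[OF j mut])

lemma M'_j: "M' (unitv j) = M (pexp j B) + M (nexp j B)"
  using mut by (simp add: mut_at_def)

context
  fixes lam :: "('n \<Rightarrow> int) \<Rightarrow> int"
  assumes lam_add: "lam (f + g) = lam f + lam g"
    and lam_col: "lam (col B j) = 0"
begin

lemma lam_zero: "lam 0 = 0"
  using lam_add[of 0 0] by simp

text \<open>As \<open>lam\<close> vanishes on column \<open>j\<close>, the two terms of
  \<open>M' (unitv j)\<close> have equal degree. Nonnegative \<open>f j\<close> avoids inverting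
  this binomial.\<close>

lemma nonneg_homogeneous:
  assumes "0 \<le> f j"
  shows "M' f \<in> lspan h M {g. lam g = lam (tr j (nexp j B) f)}"
proof -
  let ?F = "\<lambda>f. {g. lam g = lam (tr j (nexp j B) f)}"
  have "M' f \<in> lspan h M (?F f)"
  proof (rule vec_induct[where P = "\<lambda>f. M' f \<in> lspan h M (?F f)"])
    have "tr j (nexp j B) 0 = 0" by (simp add: tr_fixed)
    then show "M' 0 \<in> lspan h M (?F 0)"
      using lspan_gen[of 0 "?F 0" M h] by (simp add: lam_zero)
    show "M' (f + g) \<in> lspan h M (?F (f + g))"
      if "M' f \<in> lspan h M (?F f)" "M' g \<in> lspan h M (?F g)" for f g
      unfolding mut.M_add
      by (rule lspan_powi, rule span_mult[OF that]) (simp add: tr_add lam_add)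
    show "M' (unitv i) \<in> lspan h M (?F (unitv i))" for i
    proof (cases "i = j")
      case True
      have "lam (pexp j B) = lam (nexp j B)" by (simp add: pexp_eq lam_add lam_col)
      then show ?thesis using True
        by (auto simp: M'_j tr_unitv intro!: lspan_add lspan_gen)
    next
      case False
      then have "unitv i j = 0" by (simp add: unitv_def)
      then show ?thesis by (simp add: agree tr_fixed lspan_gen)
    qed
    show "M' (- unitv i) \<in> lspan h M (?F (- unitv i))" if "f i < 0" for i
    proof -
      have "unitv i j = 0" using that assms by (auto simp: unitv_def)
      then show ?thesis by (simp add: agree tr_fixed lspan_gen)
    qed
  qed
  then show ?thesis .
qed

text \<open>Finitely many exponents occur, so a high power of \<open>M' (unitv j)\<close> makes all
  of them nonnegative at \<open>j\<close>. Validity for every large \<open>n\<close> lets two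
  elements share one power.\<close>

lemma shift_homogeneous:
  assumes "x \<in> lspan h M' F"
  shows "\<exists>N. \<forall>n\<ge>N. x * M' (\<lambda>i. int n * unitv j i) \<in>
    lspan h M {g. \<exists>f\<in>F. lam g = lam (tr j (nexp j B) f) + lam (tr j (nexp j B) (\<lambda>i. int n * unitv j i))}"
  using assms
proof (induction rule: lspan.induct)
  case zero
  show ?case by (simp add: lspan.zero)
next
  case (step c f x)
  let ?F = "\<lambda>n. {g. \<exists>f\<in>F. lam g = lam (tr j (nexp j B) f) + lam (tr j (nexp j B) (\<lambda>i. int n * unitv j i))}"
  from step obtain N where N: "x * M' (\<lambda>i. int n * unitv j i) \<in> lspan h M (?F n)" if "n \<ge> N" for n
    by blast
  have "(c * M' f + x) * M' (\<lambda>i. int n * unitv j i) \<in> lspan h M (?F n)"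
    if n: "n \<ge> max N (nat (- f j))" for n
  proof -
    let ?e = "\<lambda>i. int n * unitv j i"
    have "M' (f + ?e) \<in> lspan h M {g. lam g = lam (tr j (nexp j B) (f + ?e))}"
      by (rule nonneg_homogeneous) (use n in \<open>simp; linarith\<close>)
    then have "M' (f + ?e) \<in> lspan h M (?F n)"
      by (rule lspan_mono) (use step in \<open>auto simp: tr_add lam_add\<close>)
    then show ?thesis
      using N[of n] n step
      by (simp add: distrib_right mult.assoc mut.M_mult lspan_add lspan_coeff lspan_powi)
  qed
  then show ?case by blast
qed

text \<open>Multiplying by a high power of the new variable moves an element of the mutated torus into the
  old one without disturbing the grading, so both expansions of \<open>y\<close> have the same
  graded pieces.\<close>

lemma graded_split:
  assumes "y \<in> torus h M" "y \<in> torus h M'"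
  obtains a b where "y = a + b"
    "a \<in> lspan h M {f. lam f \<in> Z}" "b \<in> lspan h M {f. lam f \<notin> Z}"
    "a \<in> lspan h M' {f. lam (tr j (nexp j B) f) \<in> Z}" "b \<in> lspan h M' {f. lam (tr j (nexp j B) f) \<notin> Z}"
proof -
  let ?t = "tr j (nexp j B)"
  obtain a b where ab: "a \<in> lspan h M {f. lam f \<in> Z}" "b \<in> lspan h M {f. lam f \<notin> Z}" "y = a + b"
    using lspan_split[OF assms(1), of "{f. lam f \<in> Z}"] by (auto simp: Collect_neg_eq Compl_eq_Diff_UNIV)
  obtain a' b' where ab': "a' \<in> lspan h M' {f. lam (?t f) \<in> Z}" "b' \<in> lspan h M' {f. lam (?t f) \<notin> Z}"
    "y = a' + b'"
    using lspan_split[OF assms(2), of "{f. lam (?t f) \<in> Z}"]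
    by (auto simp: Collect_neg_eq Compl_eq_Diff_UNIV)
  let ?e = "\<lambda>n i. int n * unitv j i"
  obtain N1 where N1: "a' * M' (?e n) \<in>
      lspan h M {g. \<exists>f\<in>{f. lam (?t f) \<in> Z}. lam g = lam (?t f) + lam (?t (?e n))}" if "n \<ge> N1" for n
    using shift_homogeneous[OF ab'(1)] by blast
  obtain N2 where N2: "b' * M' (?e n) \<in>
      lspan h M {g. \<exists>f\<in>{f. lam (?t f) \<notin> Z}. lam g = lam (?t f) + lam (?t (?e n))}" if "n \<ge> N2" for n
    using shift_homogeneous[OF ab'(2)] by blast
  define n where "n = max N1 N2"
  define c where "c = lam (?t (?e n))"
  have X: "M' (?e n) \<in> lspan h M {g. lam g = c}"
    unfolding c_def by (rule nonneg_homogeneous) simp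
  have "a' * M' (?e n) \<in> lspan h M {g. lam g - c \<in> Z}"
    by (rule lspan_mono[OF N1]) (auto simp: n_def c_def)
  moreover have "a * M' (?e n) \<in> lspan h M {g. lam g - c \<in> Z}"
    by (rule span_mult[OF ab(1) X]) (simp add: lam_add)
  ultimately have A: "a * M' (?e n) - a' * M' (?e n) \<in> lspan h M {g. lam g - c \<in> Z}"
    by (intro lspan_diff)
  have "b' * M' (?e n) \<in> lspan h M {g. lam g - c \<notin> Z}"
    by (rule lspan_mono[OF N2]) (auto simp: n_def c_def)
  moreover have "b * M' (?e n) \<in> lspan h M {g. lam g - c \<notin> Z}"
    by (rule span_mult[OF ab(2) X]) (simp add: lam_add)
  ultimately have "b' * M' (?e n) - b * M' (?e n) \<in> lspan h M {g. lam g - c \<notin> Z}"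
    by (intro lspan_diff)
  \<comment> \<open>After the shift this one difference lies in two complementary graded pieces,
    hence vanishes.\<close>
  moreover have eq: "a - a' = b' - b" using ab(3) ab'(3) by (simp add: algebra_simps)
  then have "a * M' (?e n) - a' * M' (?e n) = b' * M' (?e n) - b * M' (?e n)"
    by (simp flip: left_diff_distrib)
  ultimately have "a * M' (?e n) - a' * M' (?e n) = 0"
    using span_disjoint[OF A] by auto
  then have "a = a'" by (simp flip: left_diff_distrib)
  with eq have "b = b'" by simp
  show thesis using that[OF ab(3,1,2)] ab'(1,2) \<open>a = a'\<close> \<open>b = b'\<close> by simp
qed

end

lemma nonneg_mono_torus:
  assumes "0 \<le> f j"
  shows "M f \<in> torus h M'"
proof -
  interpret rev: seed_mutation h ex d "mutB j B" "mutL j B L" M' j M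
    by (rule reverse)
  show ?thesis
    using rev.nonneg_homogeneous[of "\<lambda>_. 0" f] assms by (simp add: lspan_torus)
qed

lemma nonneg_torus: "x \<in> lspan h M {f. 0 \<le> f j} \<Longrightarrow> x \<in> torus h M'"
  by (induction rule: lspan.induct)
    (auto intro: lspan.zero lspan_add lspan_coeff nonneg_mono_torus)

text \<open>The grading is the exponent at \<open>j\<close>, which vanishes on column
  \<open>j\<close> and is negated by \<open>tr j (nexp j B)\<close>. The part of negative degree in
  the old frame therefore has positive exponents in the new one.\<close>

lemma two_torus_split:
  assumes "y \<in> torus h M" "y \<in> torus h M'"
  obtains a b where "y = a + b" "a \<in> lspan h M {f. 0 \<le> f j}" "b \<in> lspan h M' {f. 0 \<le> f j}"
proof -
  obtain a b where ab: "y = a + b" "a \<in> lspan h M {f. f j \<in> {0..}}"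
    "b \<in> lspan h M' {f. tr j (nexp j B) f j \<notin> {0..}}"
    by (rule graded_split[of "\<lambda>f. f j" y "{0..}", OF _ _ assms]) (simp_all add: B_diag j)
  have "b \<in> lspan h M' {f. 0 \<le> f j}"
    by (rule lspan_mono[OF ab(3)]) (auto simp: tr_at nexp_k j)
  with ab that show thesis by auto
qed

text \<open>The lowest graded piece of \<open>(M g + M (g + b)) * y\<close> is \<open>M g\<close> times that of \<open>y\<close>.\<close>

lemma binomial_cancel:
  fixes lam :: "('n \<Rightarrow> int) \<Rightarrow> int"
  assumes lam: "\<And>f g. lam (f + g) = lam f + lam g" "lam (col B j) = 0" "0 < lam b"
    and g: "g j = 0" and b: "0 \<le> b j"
    and y: "y \<in> torus h M" and xy: "(M g + M (g + b)) * y \<in> torus h M'"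
  shows "y \<in> torus h M'"
proof -
  let ?x = "M g + M (g + b)"
  have x': "?x \<in> torus h M'" and xg: "M (- g) \<in> torus h M'"
    using g b by (auto intro!: lspan_add nonneg_mono_torus)
  \<comment> \<open>The number \<open>r\<close> counts the degrees that may still occur; each round
    removes the lowest one, \<open>m\<close>.\<close>
  have bounded: "y \<in> torus h M'"
    if "y \<in> lspan h M {f. m \<le> lam f \<and> lam f < m + int r}" "?x * y \<in> torus h M'" for m r y
    using that
  proof (induction r arbitrary: m y)
    case 0
    then have "y = 0" using span_disjoint[OF 0(1) 0(1)] by auto
    then show ?case by (simp add: lspan.zero)
  next
    case (Suc r)
    obtain a c where ac: "a \<in> lspan h M {f. lam f = m}"
        "c \<in> lspan h M {f. m + 1 \<le> lam f \<and> lam f < (m + 1) + int r}" "y = a + c"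
    proof (rule lspan_split[OF Suc.prems(1), of "{f. lam f = m}"])
      fix a c
      assume "a \<in> lspan h M ({f. m \<le> lam f \<and> lam f < m + int (Suc r)} \<inter> {f. lam f = m})"
        "c \<in> lspan h M ({f. m \<le> lam f \<and> lam f < m + int (Suc r)} - {f. lam f = m})" "y = a + c"
      then show thesis by (intro that) (auto elim!: lspan_mono)
    qed
    have low: "M g * a \<in> lspan h M {f. lam f = m + lam g}"
      by (rule span_mult[OF lspan_gen[of _ "{g}"] ac(1)]) (auto simp: lam)
    have "M (g + b) * a \<in> lspan h M {f. lam f \<noteq> m + lam g}"
      by (rule span_mult[OF lspan_gen[of _ "{g + b}"] ac(1)]) (use lam in auto)
    moreover have "lam g \<le> lam (g + b)" using lam(1)[of g b] lam(3) by linarith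
    then have "?x \<in> lspan h M {f. lam g \<le> lam f}"
      by (intro lspan_add lspan_gen CollectI) (assumption | rule order_refl)+
    then have "?x * c \<in> lspan h M {f. lam f \<noteq> m + lam g}"
      by (rule span_mult[OF _ ac(2)]) (auto simp: lam)
    ultimately have high: "M (g + b) * a + ?x * c \<in> lspan h M {f. lam f \<noteq> m + lam g}"
      by (rule lspan_add)
    have xy: "?x * y = M g * a + (M (g + b) * a + ?x * c)"
      by (simp add: ac(3) algebra_simps)
    have "?x * y \<in> torus h M"
      unfolding xy by (rule lspan_add[OF lspan_torus[OF low] lspan_torus[OF high]])
    \<comment> \<open>The piece of degree \<open>m + lam g\<close> is the same in both expansions of
      \<open>?x * y\<close>, and in the old frame it is \<open>M g * a\<close>.\<close>
    then obtain a' c' where ac': "?x * y = a' + c'" "a' \<in> lspan h M {f. lam f \<in> {m + lam g}}"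
        "c' \<in> lspan h M {f. lam f \<notin> {m + lam g}}"
        "a' \<in> lspan h M' {f. lam (tr j (nexp j B) f) \<in> {m + lam g}}"
      by (rule graded_split[of lam, OF lam(1,2) _ Suc.prems(2)])
    have "M g * a - a' \<in> lspan h M {f. lam f = m + lam g}"
      using low ac'(2) by (simp add: lspan_diff)
    moreover have "M g * a - a' = c' - (M (g + b) * a + ?x * c)"
      using xy ac'(1) by (simp add: algebra_simps)
    then have "M g * a - a' \<in> lspan h M {f. lam f \<noteq> m + lam g}"
      using high ac'(3) by (simp add: lspan_diff)
    ultimately have "M g * a - a' = 0"
      by (rule span_disjoint) auto
    then have "M g * a \<in> torus h M'" using lspan_torus[OF ac'(4)] by simp
    \<comment> \<open>Since \<open>g j = 0\<close>, the inverse of \<open>M g\<close> also lies in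
      the mutated torus.\<close>
    then have "M (- g) * (M g * a) \<in> torus h M'" using xg by (rule mut.torus_mult[rotated])
    then have a: "a \<in> torus h M'" by (simp add: M_neg mult.assoc[symmetric])
    have "?x * y - ?x * a = ?x * c" by (simp add: ac(3) algebra_simps)
    with lspan_diff[OF Suc.prems(2) mut.torus_mult[OF x' a]] have "?x * c \<in> torus h M'"
      by (simp only:)
    then have "c \<in> torus h M'" by (rule Suc.IH[OF ac(2)])
    with a show ?case unfolding ac(3) by (intro lspan_add)
  qed
  have "\<exists>K. y \<in> lspan h M {f. \<bar>lam f\<bar> \<le> K}"
    using y
  proof (induction rule: lspan.induct)
    case zero
    show ?case by (blast intro: lspan.zero)
  next
    case (step c f x)
    then obtain K where "x \<in> lspan h M {f. \<bar>lam f\<bar> \<le> K}" by blast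
    then have "x \<in> lspan h M {e. \<bar>lam e\<bar> \<le> max K \<bar>lam f\<bar>}"
      by (rule lspan_mono) auto
    with step have "c * M f + x \<in> lspan h M {e. \<bar>lam e\<bar> \<le> max K \<bar>lam f\<bar>}"
      by (intro lspan.step) auto
    then show ?case by blast
  qed
  then obtain K where "y \<in> lspan h M {f. \<bar>lam f\<bar> \<le> K}" by blast
  \<comment> \<open>There are \<open>2 * K + 1\<close> degrees from \<open>- K\<close> to
    \<open>K\<close>; for negative \<open>K\<close> both exponent sets are empty.\<close>
  then have "y \<in> lspan h M {f. - K \<le> lam f \<and> lam f < - K + int (nat (2 * K + 1))}"
    by (rule lspan_mono) auto
  with bounded xy show ?thesis by blast
qed

end

context seed
begin

lemma M_power: "M (\<lambda>i. int m * unitv k i) = M (unitv k) ^ m"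
proof (induction m)
  case 0
  have "(\<lambda>i. int 0 * unitv k i) = 0" by (simp add: fun_eq_iff)
  then show ?case by (simp only: M_zero power_0)
next
  case (Suc m)
  have "(\<lambda>i. int (Suc m) * unitv k i) = unitv k + (\<lambda>i. int m * unitv k i)"
    by (simp add: fun_eq_iff algebra_simps)
  then have "M (\<lambda>i. int (Suc m) * unitv k i) = M (unitv k) * M (\<lambda>i. int m * unitv k i)"
    using bil_self[of "unitv k"] by (simp add: M_add bil_scale_right del: of_nat_Suc)
  then show ?case by (simp add: Suc)
qed

lemma mono_absorb:
  assumes R: "\<And>x y. x \<in> R \<Longrightarrow> y \<in> R \<Longrightarrow> x * y \<in> R" "coeffs h \<subseteq> R"
    and unitv: "\<And>i. M (unitv i) \<in> R" "\<And>i. i \<noteq> k \<Longrightarrow> i \<noteq> j \<Longrightarrow> M (- unitv i) \<in> R"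
    and f: "0 \<le> f j" "0 \<le> f k"
  shows "M f \<in> R"
proof (rule vec_induct[where P = "\<lambda>f. M f \<in> R" and f = f])
  show "M 0 \<in> R" using R(2) subring_gen.one[of "{h, inverse h}"] by auto
  show "M (f + g) \<in> R" if "M f \<in> R" "M g \<in> R" for f g
    unfolding M_add using that R coeffs_powi by blast
  show "M (- unitv i) \<in> R" if "f i < 0" for i
    using that f by (intro unitv) auto
qed (rule unitv)

text \<open>A power of \<open>M (unitv k)\<close> repairs the negative exponents at
  \<open>k\<close>, and those at \<open>j\<close> are nonnegative already. Thus \<open>R\<close>,
  later the torus of the seed mutated twice, needs inverse variables only in the other
  directions.\<close>

lemma absorb:
  assumes R: "0 \<in> R" "\<And>x y. x \<in> R \<Longrightarrow> y \<in> R \<Longrightarrow> x + y \<in> R"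
      "\<And>x y. x \<in> R \<Longrightarrow> y \<in> R \<Longrightarrow> x * y \<in> R" "coeffs h \<subseteq> R"
    and unitv: "\<And>i. M (unitv i) \<in> R" "\<And>i. i \<noteq> k \<Longrightarrow> i \<noteq> j \<Longrightarrow> M (- unitv i) \<in> R"
    and y: "y \<in> lspan h M {f. 0 \<le> f j}" and "j \<noteq> k"
  shows "\<exists>N. \<forall>m\<ge>N. M (unitv k) ^ m * y \<in> R"
  using y
proof (induction rule: lspan.induct)
  case zero
  show ?case using R by simp
next
  case (step c f y)
  then obtain N where N: "M (unitv k) ^ m * y \<in> R" if "m \<ge> N" for m by blast
  have "M (unitv k) ^ m * (c * M f + y) \<in> R" if m: "m \<ge> max N (nat (- f k))" for m
  proof -
    let ?e = "\<lambda>i. int m * unitv k i"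
    have "M (unitv k) ^ m * (c * M f + y) =
        c * (h powi bil L ?e f * M (?e + f)) + M (unitv k) ^ m * y"
      using coeffs_central[OF step(1), of "M ?e"]
      by (simp add: distrib_left M_mult[symmetric] M_power[symmetric])
        (simp add: mult.assoc[symmetric])
    moreover have "M (?e + f) \<in> R"
      by (rule mono_absorb[OF R(3,4) unitv]) (use step m \<open>j \<noteq> k\<close> in \<open>auto simp: unitv_other\<close>)
    moreover have "c \<in> R" "h powi bil L ?e f \<in> R"
      using R(4) step(1) coeffs_powi[of h] by auto
    moreover have "M (unitv k) ^ m * y \<in> R" using m by (intro N) simp
    ultimately show ?thesis by (simp only: R(2,3))
  qed
  then show ?case by blast
qed

end

section \<open>Mutations in two different directions\<close>

locale seed_two_mutations = seed_mutation h ex d B L M k M1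
  for h :: "'a::division_ring" and ex :: "'n::finite set" and d B L M k M1 +
  fixes j M2 M12
  assumes jex: "j \<in> ex" and jk: "j \<noteq> k"
    and mut2: "mut_at h j M B L M2"
    and mut12: "mut_at h j M1 (mutB k B) (mutL k B L) M12"
begin

text \<open>The inherited locale is instantiated with direction \<open>k\<close>, so its fact
  \<open>j\<close> now states \<open>k \<in> ex\<close>.\<close>

lemmas k = j

sublocale s2: seed_mutation h ex d B L M j M2
  by unfold_locales (rule jex mut2)+

sublocale s12: seed_mutation h ex d "mutB k B" "mutL k B L" M1 j M12
  by unfold_locales (rule jex mut12)+

abbreviation "T \<equiv> torus h M12"

text \<open>The sign is chosen such that \<open>M1 lead\<close> is the term of \<open>M (unitv k)\<close> of lowest degree in
  direction \<open>j\<close>, and this degree is zero.\<close>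

definition lead :: "'n \<Rightarrow> int" where
  "lead = (if 0 \<le> B j k then nexp k B else pexp k B)"

definition gap :: "'n \<Rightarrow> int" where
  "gap = (if 0 \<le> B j k then col B k else - col B k)"

lemma lead_k: "lead k = -1" and lead_j: "lead j = 0"
  and gap_j: "gap j = \<bar>B j k\<bar>"
  using jk by (auto simp: lead_def gap_def nexp_def pexp_def unitv_def B_diag[OF k])

lemma M_k: "M (unitv k) = M1 lead + M1 (lead + gap)"
proof -
  have "M (unitv k) = M1 (nexp k B) + M1 (pexp k B)"
    using mut_reverse[OF k mut] by (simp add: mut_at_def pexp_mutB nexp_mutB)
  then show ?thesis by (simp add: lead_def gap_def pexp_eq add.commute)
qed

lemma bil_lead: "bil (mutL k B L) (tr k lead f) (tr k lead g) = bil L f g"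
  using bil_mutL_n[OF k, of "tr k lead f" "tr k lead g"] bil_mutL_p[OF k, of "tr k lead f" "tr k lead g"]
  by (cases "0 \<le> B j k") (simp_all add: lead_def tr_tr nexp_k[OF k] pexp_k[OF k])

lemma tr_lead_j: "tr k lead f j = f j"
  using jk by (simp add: tr_def unitv_def lead_j)

text \<open>Entries \<open>B j k\<close> and \<open>B k j\<close> have opposite signs, so the sign
  chosen for \<open>lead\<close> is the one for which the added multiple of column \<open>k\<close>
  cancels.\<close>

lemma tr_lead_col: "tr k lead (col B j) = col (mutB k B) j"
proof -
  have "tr k lead (col (mutB k B) j) = col B j"
  proof (cases "0 \<le> B j k")
    case True
    then have "d k * B k j \<le> 0"
      using DB_skew[OF k jex] d_pos[OF jex] by simp
    then have "B k j \<le> 0" using d_pos[OF k] by (simp add: mult_le_0_iff)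
    with True show ?thesis
      using tr_nexp_col_mutB[OF k jk] by (simp add: lead_def fun_eq_iff)
  next
    case False
    then have "0 < d k * B k j"
      using DB_skew[OF k jex] d_pos[OF jex] by (simp add: mult_pos_neg)
    then have "0 < B k j" using d_pos[OF k] by (simp add: zero_less_mult_iff)
    with False show ?thesis
      using tr_nexp_col_mutB[OF k jk] by (simp add: lead_def tr_pexp fun_eq_iff mutB_def)
  qed
  then show ?thesis using tr_tr[of lead k "col (mutB k B) j"] lead_k by simp
qed

text \<open>Each factor \<open>M (unitv k)\<close> contributes \<open>M1 lead\<close> of degree 0 at
  \<open>j\<close> and a term of degree \<open>gap j\<close>. As \<open>tr k lead\<close> carries
  one form to the other, the leading coefficient is exactly 1. For \<open>gap j = 0\<close> the
  degrees coincide, hence the alternative \<open>f k = 0\<close>.\<close>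

lemma leading_term:
  assumes "0 \<le> f k" and gap: "0 < gap j \<or> f k = 0"
  shows "M f - M1 (tr k lead f) \<in> lspan h M1 {e. f j < e j}"
proof -
  let ?L1 = "mutL k B L"
  have *: "M (f0 + (\<lambda>i. int m * unitv k i)) - M1 (tr k lead (f0 + (\<lambda>i. int m * unitv k i)))
      \<in> lspan h M1 {e. f0 j < e j}"
    if "f0 k = 0" "0 < gap j \<or> m = 0" for f0 m
    using that(2)
  proof (induction m)
    case 0
    have "f0 + (\<lambda>i. int 0 * unitv k i) = f0" by (simp add: fun_eq_iff)
    with that(1) show ?case by (simp only: tr_fixed agree diff_self lspan.zero)
  next
    case (Suc m)
    then have gap_pos: "0 < gap j" by simp
    let ?f = "f0 + (\<lambda>i. int m * unitv k i)"
    let ?t = "tr k lead ?f" and ?s = "bil L ?f (unitv k)"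
    have f_eq: "f0 + (\<lambda>i. int (Suc m) * unitv k i) = ?f + unitv k"
      by (simp add: fun_eq_iff algebra_simps)
    have t_eq: "tr k lead (?f + unitv k) = ?t + lead" by (simp add: tr_add tr_unitv)
    have "bil ?L1 ?t lead = ?s" using bil_lead[of ?f "unitv k"] by (simp add: tr_unitv)
    then have "M1 (?t + lead) = h powi (- ?s) * (M1 ?t * M1 lead)"
      using mut.M_add[of ?t lead] by simp
    moreover have "(M ?f - M1 ?t) * M (unitv k) + M1 ?t * M1 (lead + gap) =
        M ?f * M (unitv k) - M1 ?t * M1 lead"
      by (simp add: M_k distrib_left left_diff_distrib)
    ultimately have "M (?f + unitv k) - M1 (?t + lead) =
        h powi (- ?s) * ((M ?f - M1 ?t) * M (unitv k) + M1 ?t * M1 (lead + gap))"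
      using M_add[of ?f "unitv k"] by (simp only: right_diff_distrib)
    moreover have "(M ?f - M1 ?t) * M (unitv k) \<in> lspan h M1 {e. f0 j < e j}"
    proof (rule mut.span_mult)
      show "M ?f - M1 ?t \<in> lspan h M1 {e. f0 j < e j}"
        by (rule Suc.IH) (simp add: gap_pos)
      show "M (unitv k) \<in> lspan h M1 {e. 0 \<le> e j}"
        unfolding M_k by (intro lspan_add lspan_gen) (auto simp: lead_j gap_j)
    qed auto
    moreover have "M1 ?t * M1 (lead + gap) \<in> lspan h M1 {e. f0 j < e j}"
      unfolding mut.M_mult
      by (rule lspan_powi_gen) (use gap_pos jk in \<open>simp add: tr_lead_j lead_j unitv_other\<close>)
    ultimately show ?case
      unfolding f_eq t_eq by (simp only: lspan_powi lspan_add)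
  qed
  define f0 where "f0 = f - (\<lambda>i. f k * unitv k i)"
  have f0: "f = f0 + (\<lambda>i. int (nat (f k)) * unitv k i)" "f0 k = 0" "f0 j = f j"
    using assms jk by (auto simp: f0_def fun_eq_iff unitv_other)
  have "0 < gap j \<or> nat (f k) = 0" using gap by auto
  with *[of f0 "nat (f k)"] f0(2) show ?thesis unfolding f0(3) f0(1)[symmetric] by blast
qed

lemma B_jk_zero: "B j k = 0 \<longleftrightarrow> B k j = 0"
  using DB_skew[OF k jex] d_pos[OF k] d_pos[OF jex] by auto

lemma M1_neighbour: "0 \<le> f j \<Longrightarrow> M1 f \<in> T"
  by (rule s12.nonneg_mono_torus)

text \<open>The exponent at \<open>j\<close> is \<open>-1\<close>, so all terms above the leading
  one have nonnegative exponent there and survive the mutation at \<open>j\<close>.\<close>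

lemma exchange_monomial:
  assumes "f = pexp j B \<or> f = nexp j B"
  shows "M f - M1 (tr k lead f) \<in> T"
proof -
  have f: "0 \<le> f k" "f j = -1" "B k j = 0 \<longrightarrow> f k = 0"
    using assms jk pexp_k[OF jex] nexp_k[OF jex] by (auto simp: pexp_def nexp_def unitv_def)
  have "0 < gap j \<or> f k = 0" using f(3) B_jk_zero gap_j by auto
  with leading_term[of f] f(1) have "M f - M1 (tr k lead f) \<in> lspan h M1 {e. f j < e j}"
    by blast
  then have "M f - M1 (tr k lead f) \<in> lspan h M1 {e. 0 \<le> e j}"
    by (rule lspan_mono) (use f in auto)
  then show ?thesis by (rule s12.nonneg_torus)
qed

text \<open>The leading terms of the two exchange monomials differ by column \<open>j\<close> of
  \<open>mutB k B\<close>. Their sum is therefore, up to a power of \<open>h\<close>,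
  \<open>M1 v * M12 (unitv j)\<close> with \<open>v j = 0\<close>; the remainders are covered by
  \<open>exchange_monomial\<close>.\<close>

lemma M2_j_neighbour: "M2 (unitv j) \<in> T"
proof -
  let ?B1 = "mutB k B" and ?L1 = "mutL k B L"
  let ?p = "tr k lead (pexp j B)" and ?n = "tr k lead (nexp j B)"
  define v where "v = ?n - nexp j ?B1"
  have v: "v j = 0"
    by (simp add: v_def tr_lead_j nexp_k[OF jex] mut.nexp_k[OF jex])
  have n: "v + nexp j ?B1 = ?n" by (simp add: v_def)
  have p: "v + pexp j ?B1 = ?p"
    by (simp add: v_def pexp_eq[of j] tr_add tr_lead_col)
  have "bil ?L1 v (pexp j ?B1) = bil ?L1 v (nexp j ?B1)"
    using v by (simp add: pexp_eq[of j] bil_add_right mut.bil_col_right[OF jex])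
  then have "M1 v * M12 (unitv j) = h powi (bil ?L1 v (nexp j ?B1)) * (M1 ?p + M1 ?n)"
    by (simp add: s12.M'_j distrib_left mut.M_mult n p)
  then have "M1 ?p + M1 ?n = h powi (- bil ?L1 v (nexp j ?B1)) * (M1 v * M12 (unitv j))"
    by (simp add: power_int_minus mult.assoc[symmetric])
  moreover have "M1 v * M12 (unitv j) \<in> T"
    using v by (intro s12.mut.torus_mult M1_neighbour s12.mut.M_torus) simp
  ultimately have "M1 ?p + M1 ?n \<in> T" by (simp add: lspan_powi)
  moreover have "M (pexp j B) - M1 ?p \<in> T" "M (nexp j B) - M1 ?n \<in> T"
    by (auto intro: exchange_monomial)
  ultimately have "(M1 ?p + M1 ?n) + ((M (pexp j B) - M1 ?p) + (M (nexp j B) - M1 ?n)) \<in> T"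
    by (rule lspan_add[OF _ lspan_add])
  then show ?thesis by (simp add: s2.M'_j algebra_simps)
qed

lemma M_k_neighbour: "M (unitv k) \<in> T"
  unfolding M_k by (intro lspan_add M1_neighbour) (auto simp: lead_j gap_j)

lemma M_unitv_neighbour: "M (unitv i) \<in> T"
proof (cases "i = k")
  case False
  then have "M (unitv i) = M1 (unitv i)" by (intro agree[symmetric]) (simp add: unitv_def)
  then show ?thesis by (simp add: M1_neighbour unitv_def)
qed (simp add: M_k_neighbour)

lemma M_neg_unitv_neighbour: "i \<noteq> k \<Longrightarrow> i \<noteq> j \<Longrightarrow> M (- unitv i) \<in> T"
  using agree[of "- unitv i"] M1_neighbour[of "- unitv i"] by (simp add: unitv_def)

text \<open>Pairing with \<open>unitv k\<close> is 0 on the mutated column \<open>j\<close> and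
  nonzero on \<open>gap\<close>, and that column is itself nonzero, so the two are not proportional.
  A nonzero two-by-two minor, with its sign \<open>s\<close>, yields the functional.\<close>

lemma separating_functional:
  obtains lam :: "('n \<Rightarrow> int) \<Rightarrow> int" where "\<And>f g. lam (f + g) = lam f + lam g"
    "lam (col (mutB k B) j) = 0" "0 < lam gap"
proof -
  let ?b = "col (mutB k B) j" and ?L1 = "mutL k B L"
  have "\<exists>i i'. gap i * ?b i' \<noteq> gap i' * ?b i"
  proof (rule ccontr)
    assume "\<nexists>i i'. gap i * ?b i' \<noteq> gap i' * ?b i"
    then have parallel: "(\<lambda>i. ?b i' * gap i) = (\<lambda>i. gap i' * ?b i)" for i'
      by (auto simp: fun_eq_iff mult.commute)
    have "?b i' = 0" for i'
    proof -
      have "?b i' * bil ?L1 gap (unitv k) = gap i' * bil ?L1 ?b (unitv k)"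
        using parallel[of i'] by (metis bil_scale_left)
      also have "bil ?L1 ?b (unitv k) = 0"
        using mut.bil_col[OF jex, of "unitv k"] jk by (simp add: unitv_other)
      finally have "?b i' * bil ?L1 gap (unitv k) = 0" by simp
      moreover have "col (mutB k B) k = - col B k" by (auto simp: mutB_def fun_eq_iff)
      then have "gap = col (mutB k B) k \<or> gap = - col (mutB k B) k" by (auto simp: gap_def)
      then have "bil ?L1 gap (unitv k) \<noteq> 0"
        using mut.bil_col[OF k, of "unitv k"] d_pos[OF k] by (auto simp: bil_uminus_left)
      ultimately show ?thesis by simp
    qed
    then have "?b = 0" by (simp add: fun_eq_iff)
    then have "bil ?L1 ?b (unitv j) = 0" by (simp only: bil_zero)
    then show False using mut.bil_col[OF jex, of "unitv j"] d_pos[OF jex] by simp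
  qed
  then obtain i i' where i: "gap i * ?b i' - gap i' * ?b i \<noteq> 0" by auto
  define s where "s = sgn (gap i * ?b i' - gap i' * ?b i)"
  show thesis
  proof (rule that[of "\<lambda>f. s * (f i * ?b i' - f i' * ?b i)"])
    show "0 < s * (gap i * ?b i' - gap i' * ?b i)"
      using i by (simp add: s_def sgn_if)
  qed (simp_all add: algebra_simps)
qed

text \<open>In rank two, \<open>M2 (unitv j)\<close> already lies in the torus of the seed mutated twice, so
  a power of \<open>M (unitv k)\<close> carries \<open>y\<close> into that torus; the factor is then cancelled.\<close>

lemma rank_two_torus:
  assumes "y \<in> torus h M" "y \<in> torus h M1" "y \<in> torus h M2"
  shows "y \<in> T"
proof -
  obtain a b where ab: "y = a + b" "a \<in> lspan h M {f. 0 \<le> f j}" "b \<in> lspan h M2 {f. 0 \<le> f j}"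
    using s2.two_torus_split[OF assms(1,3)] by blast
  have coeffs_T: "coeffs h \<subseteq> T" using s12.mut.torus_coeffs by auto
  note T = lspan.zero lspan_add s12.mut.torus_mult coeffs_T
  obtain N where N: "M (unitv k) ^ m * a \<in> T" if "m \<ge> N" for m
    using absorb[OF T M_unitv_neighbour M_neg_unitv_neighbour ab(2) jk] by blast
  \<comment> \<open>The summand \<open>b\<close> is expanded in the frame \<open>M2\<close>, whose
    only variable not shared with \<open>M\<close> is the one at \<open>j\<close>.\<close>
  have M2: "M2 (unitv i) \<in> T" for i
    using M_unitv_neighbour[of i] M2_j_neighbour s2.agree[of "unitv i"]
    by (cases "i = j") (auto simp: unitv_other)
  have M2_neg: "M2 (- unitv i) \<in> T" if "i \<noteq> k" "i \<noteq> j" for i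
    using M_neg_unitv_neighbour[OF that] s2.agree[of "- unitv i"] that by (simp add: unitv_other)
  obtain N' where N': "M2 (unitv k) ^ m * b \<in> T" if "m \<ge> N'" for m
    using s2.mut.absorb[OF T M2 M2_neg ab(3) jk] by blast
  define m where "m = max N N'"
  have "M2 (unitv k) = M (unitv k)" using jk by (intro s2.agree) (simp add: unitv_other)
  then have "M (unitv k) ^ m * y \<in> T"
    using N[of m] N'[of m] by (simp add: ab(1) distrib_left m_def lspan_add)
  then show ?thesis
  proof (induction m)
    case (Suc m)
    obtain lam :: "('n \<Rightarrow> int) \<Rightarrow> int" where lam: "\<And>f g. lam (f + g) = lam f + lam g"
      "lam (col (mutB k B) j) = 0" "0 < lam gap"
      using separating_functional by blast
    \<comment> \<open>One factor \<open>M (unitv k)\<close> is cancelled as a binomial in the frame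
      \<open>M1\<close>; the rest lies in the torus of \<open>M1\<close> because \<open>y\<close>
      does.\<close>
    have "M (unitv k) ^ m * y \<in> T"
    proof (rule s12.binomial_cancel[where lam = lam and g = lead and b = gap, OF lam lead_j])
      show "M (unitv k) ^ m * y \<in> torus h M1"
        by (intro mut.torus_mult mut.torus_power assms) (simp add: M_k lspan_add mut.M_torus)
      show "(M1 lead + M1 (lead + gap)) * (M (unitv k) ^ m * y) \<in> T"
        using Suc.prems by (simp add: M_k[symmetric] mult.assoc)
    qed (simp add: gap_j)
    then show ?case by (rule Suc.IH)
  qed simp
qed

end

section \<open>Invariance of upper bounds under mutation\<close>

definition upper_bound ::
  "'a::division_ring \<Rightarrow> 'n::finite set \<Rightarrow> (('n \<Rightarrow> int) \<Rightarrow> 'a) \<Rightarrow> ('n \<Rightarrow> 'n \<Rightarrow> int) \<Rightarrow> ('n \<Rightarrow> 'n \<Rightarrow> int) \<Rightarrow> 'a set" where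
  "upper_bound h ex M B L =
     {y \<in> torus h M. \<forall>j\<in>ex. \<forall>M'. mut_at h j M B L M' \<longrightarrow> y \<in> torus h M'}"

context seed
begin

text \<open>The neighbour of the mutated seed in direction \<open>k\<close> is the old seed, by
  uniqueness. In another direction \<open>j\<close>, existence of the mutation of the old seed at
  \<open>j\<close> supplies the third torus required by \<open>rank_two_torus\<close>.\<close>

lemma upper_bound_mono:
  assumes k: "k \<in> ex" and mut: "mut_at h k M B L M1"
  shows "upper_bound h ex M B L \<subseteq> upper_bound h ex M1 (mutB k B) (mutL k B L)"
proof
  fix y
  assume y: "y \<in> upper_bound h ex M B L"
  interpret mut: seed_mutation h ex d B L M k M1
    by unfold_locales (rule k mut)+
  show "y \<in> upper_bound h ex M1 (mutB k B) (mutL k B L)"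
    unfolding upper_bound_def
  proof (intro CollectI conjI ballI allI impI)
    show "y \<in> torus h M1" using y k mut by (auto simp: upper_bound_def)
    fix j M12
    assume j: "j \<in> ex" and mut12: "mut_at h j M1 (mutB k B) (mutL k B L) M12"
    show "y \<in> torus h M12"
    proof (cases "j = k")
      case True
      then have "M12 = M"
        using mut.mut.mut_unique[OF k _ mut_reverse[OF k mut]] mut12 by simp
      then show ?thesis using y by (simp add: upper_bound_def)
    next
      case False
      obtain M2 where M2: "mut_at h j M B L M2" using mut_exists[OF j] by blast
      interpret seed_two_mutations h ex d B L M k M1 j M2 M12
        by unfold_locales (use j False M2 mut12 in auto)
      show ?thesis
        by (rule rank_two_torus) (use y j k mut M2 in \<open>auto simp: upper_bound_def\<close>)
    qed
  qed
qed

lemma upper_bound_eq: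
  assumes k: "k \<in> ex" and mut: "mut_at h k M B L M1"
  shows "upper_bound h ex M1 (mutB k B) (mutL k B L) = upper_bound h ex M B L"
proof -
  interpret mut: seed h ex d "mutB k B" "mutL k B L" M1
    by (rule mutated_seed[OF k mut])
  show ?thesis
    using upper_bound_mono[OF k mut] mut.upper_bound_mono[OF k mut_reverse[OF k mut]]
    by (simp add: mutB_mutB mutL_mutL[OF k])
qed

text \<open>A variable has no negative exponent, so it survives any single mutation; invariance
  extends this to all sequences.\<close>

lemma variable_upper_bound: "M (unitv i) \<in> upper_bound h ex M B L"
  unfolding upper_bound_def
proof (intro CollectI conjI ballI allI impI)
  show "M (unitv i) \<in> torus h M" by (rule M_torus)
  fix j M'
  assume "j \<in> ex" "mut_at h j M B L M'"
  then interpret seed_mutation h ex d B L M j M' by unfold_locales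
  show "M (unitv i) \<in> torus h M'" by (rule nonneg_mono_torus) (simp add: unitv_def)
qed

lemma reachable:
  assumes "(mut_step ex (toric_frame h))\<^sup>*\<^sup>* (M, B, L) (M', B', L')"
  shows "seed h ex d B' L' M' \<and> upper_bound h ex M' B' L' = upper_bound h ex M B L"
  using assms
proof (induction "(M', B', L')" arbitrary: M' B' L' rule: rtranclp_induct)
  case base
  show ?case using seed_axioms by simp
next
  case (step s)
  obtain M1 B1 L1 where s: "s = (M1, B1, L1)" by (cases s)
  then have IH: "seed h ex d B1 L1 M1" "upper_bound h ex M1 B1 L1 = upper_bound h ex M B L"
    using step by auto
  obtain k where k: "k \<in> ex" "B' = mutB k B1" "L' = mutL k B1 L1" "mut_at h k M1 B1 L1 M'"
    using step(2) unfolding s mut_step_iff by auto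
  show ?case
    using seed.mutated_seed[OF IH(1) k(1,4)] seed.upper_bound_eq[OF IH(1) k(1,4)] IH(2) k(2,3) by simp
qed

theorem laurent_phenomenon:
  assumes "(mut_step ex (toric_frame h))\<^sup>*\<^sup>* (M, B, L) (M', B', L')"
  shows "M' (unitv i) \<in> torus h M"
proof -
  from reachable[OF assms] have "M' (unitv i) \<in> upper_bound h ex M B L"
    using seed.variable_upper_bound by metis
  then show ?thesis by (simp add: upper_bound_def)
qed

end

section \<open>Specialization\<close>

lemma rou_frame_eq:
  assumes "eh ^ l = 1" "0 < l" "eh \<noteq> (0 :: 'a::division_ring)"
  shows "rou_frame l eh = toric_frame eh"
proof -
  have "eh ^ nat (m mod int l) = eh powi m" for m
  proof -
    have "eh powi m = eh powi (int l * (m div int l)) * eh powi (m mod int l)"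
      using assms(3) by (simp flip: power_int_add)
    also have "eh powi (int l * (m div int l)) = 1"
      by (simp add: power_int_mult assms(1))
    finally show ?thesis using assms(2) by (simp add: power_int_def)
  qed
  then show ?thesis by (simp add: rou_frame_def toric_frame_def plus_fun_def fun_eq_iff)
qed

lemma q_frame_eq:
  assumes "\<forall>p. evalp p qh = 0 \<longrightarrow> p = 0"
  shows "q_frame qh = toric_frame qh"
proof -
  have "evalp p qh = 0 \<longleftrightarrow> p = 0" for p using assms by auto
  then show ?thesis by (simp add: q_frame_def toric_frame_def plus_fun_def fun_eq_iff)
qed

text \<open>The specialization as a relation built monomial by monomial: sums and products can be
  treated before single-valuedness, which is proved separately.\<close>

inductive specializes ::
  "'g::division_ring \<Rightarrow> (('n \<Rightarrow> int) \<Rightarrow> 'g) \<Rightarrow> 'f::division_ring \<Rightarrow> (('n \<Rightarrow> int) \<Rightarrow> 'f) \<Rightarrow> 'g \<Rightarrow> 'f \<Rightarrow> bool"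
  for qh Mq eh M where
  zero: "specializes qh Mq eh M 0 0"
| step: "specializes qh Mq eh M x y \<Longrightarrow>
    specializes qh Mq eh M (of_int n * qh powi a * Mq f + x) (of_int n * eh powi a * M f + y)"

lemma specializes_sum_form:
  assumes "specializes qh Mq eh M x y"
  shows "\<exists>S c. finite S \<and> x = (\<Sum>(f, a)\<in>S. of_int (c f a) * qh powi a * Mq f) \<and>
           y = (\<Sum>(f, a)\<in>S. of_int (c f a) * eh powi a * M f)"
  using assms
proof (induction rule: specializes.induct)
  case zero
  show ?case by (intro exI[of _ "{}"]) simp
next
  case (step x y n a f)
  then obtain S c where S: "finite S" "x = (\<Sum>(f, a)\<in>S. of_int (c f a) * qh powi a * Mq f)"
    "y = (\<Sum>(f, a)\<in>S. of_int (c f a) * eh powi a * M f)" by blast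
  define e where "e g b = (if (g, b) \<in> S then c g b else 0) + (if (g, b) = (f, a) then n else 0)" for g b
  have *: "of_int n * h powi a * N f + (\<Sum>(f, a)\<in>S. of_int (c f a) * h powi a * N f) =
      (\<Sum>(g, b)\<in>insert (f, a) S. of_int (e g b) * h powi b * N g)"
    for h :: "'d::division_ring" and N
  proof -
    have "(\<Sum>(g, b)\<in>insert (f, a) S. of_int (e g b) * h powi b * N g) =
       (\<Sum>(g, b)\<in>insert (f, a) S. (if (g, b) \<in> S then of_int (c g b) * h powi b * N g else 0)) +
       (\<Sum>(g, b)\<in>insert (f, a) S. (if (g, b) = (f, a) then of_int n * h powi b * N g else 0))"
      by (simp add: sum.distrib[symmetric] split_def)
        (rule sum.cong, auto simp: e_def distrib_right)
    also have "(\<Sum>(g, b)\<in>insert (f, a) S. (if (g, b) \<in> S then of_int (c g b) * h powi b * N g else 0)) =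
       (\<Sum>(f, a)\<in>S. of_int (c f a) * h powi a * N f)"
      by (rule sum.mono_neutral_cong_right) (use S in auto)
    also have "(\<Sum>(g, b)\<in>insert (f, a) S. (if (g, b) = (f, a) then of_int n * h powi b * N g else 0)) =
       (\<Sum>(g, b)\<in>{(f, a)}. of_int n * h powi b * N g)"
      by (rule sum.mono_neutral_cong_right) (use S in \<open>auto split: if_splits\<close>)
    finally show ?thesis by (simp add: add.commute)
  qed
  show ?case
    unfolding S(2,3) using S(1) *[of qh Mq] *[of eh M]
    by (intro exI[of _ "insert (f, a) S"] exI[of _ e]) simp
qed

lemma specializes_of_sum_form:
  assumes "finite S"
  shows "specializes qh Mq eh M (\<Sum>(f, a)\<in>S. of_int (c f a) * qh powi a * Mq f)
           (\<Sum>(f, a)\<in>S. of_int (c f a) * eh powi a * M f)"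
  using assms
proof (induction S rule: finite_induct)
  case empty
  show ?case by (simp add: specializes.zero)
next
  case (insert s S)
  then show ?case by (cases s) (simp add: specializes.step)
qed

lemma kappa_image_eq:
  "kappa_image qh Mq eh M X = {y. \<exists>x\<in>X. specializes qh Mq eh M x y}"
  unfolding kappa_image_def
  using specializes_sum_form specializes_of_sum_form by (fastforce intro!: Collect_cong)

lemma (in central_unit) monomial_mult:
  assumes "toric_frame h N L"
  shows "(of_int m * h powi a * N f) * (of_int n * h powi b * N g) =
    of_int (m * n) * h powi (a + b + bil L f g) * N (f + g)"
proof -
  let ?c = "of_int m * h powi a" and ?e = "of_int n * h powi b"
  have "?e * x = x * ?e" for x
    by (metis mult.assoc mult_of_int_commute powi_central)
  then have "(?c * N f) * (?e * N g) = (?c * ?e) * (N f * N g)"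
    by (metis mult.assoc)
  also have "?c * ?e = of_int (m * n) * h powi (a + b)"
    by (simp add: powi_add) (metis mult.assoc mult_of_int_commute)
  finally show ?thesis
    by (simp only: frame_mult[OF assms] powi_add mult.assoc)
qed

text \<open>Clears negative powers of \<open>h\<close> and groups terms by exponent, so that frame
  independence applies. The coefficient polynomials do not depend on \<open>h\<close> and serve for
  \<open>qh\<close> and \<open>eh\<close> alike.\<close>

lemma (in central_unit) sum_form_eval:
  assumes "finite S" "\<And>f a. (f, a) \<in> S \<Longrightarrow> - int N \<le> a"
  shows "h ^ N * (\<Sum>(f, a)\<in>S. of_int (c f a) * h powi a * (X f :: 'a)) =
    (\<Sum>f\<in>fst ` S. evalp (\<Sum>a | (f, a) \<in> S. monom (c f a) (nat (a + int N))) h * X f)"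
proof -
  have "h ^ N * (\<Sum>(f, a)\<in>S. of_int (c f a) * h powi a * X f) =
      (\<Sum>(f, a)\<in>S. of_int (c f a) * h ^ nat (a + int N) * X f)"
    unfolding sum_distrib_left
  proof (rule sum.cong[OF refl], clarify)
    fix f a
    assume "(f, a) \<in> S"
    then have "h ^ nat (a + int N) = h ^ N * h powi a"
      using assms(2)[of f a] powi_add[of "int N" a] power_int_nonneg_exp[of "a + int N" h]
      by (simp add: add.commute)
    then show "h ^ N * (of_int (c f a) * h powi a * X f) = of_int (c f a) * h ^ nat (a + int N) * X f"
      by (metis mult.assoc mult_of_int_commute)
  qed
  also have "\<dots> = (\<Sum>(f, a)\<in>Sigma (fst ` S) (\<lambda>f. {a. (f, a) \<in> S}). of_int (c f a) * h ^ nat (a + int N) * X f)"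
    by (rule sum.cong) force+
  also have "\<dots> = (\<Sum>f\<in>fst ` S. \<Sum>a | (f, a) \<in> S. of_int (c f a) * h ^ nat (a + int N) * X f)"
  proof (rule sum.Sigma[symmetric])
    have "{a. (f, a) \<in> S} \<subseteq> snd ` S" for f by force
    then show "\<forall>f\<in>fst ` S. finite {a. (f, a) \<in> S}"
      using assms(1) by (meson finite_imageI finite_subset)
  qed (use assms in simp)
  finally show ?thesis by (simp add: evalp_sum evalp_monom sum_distrib_right)
qed

locale specialization = q: central_unit qh + e: central_unit eh
  for qh :: "'g::division_ring" and eh :: "'f::division_ring" +
  fixes Mq :: "('n::finite \<Rightarrow> int) \<Rightarrow> 'g" and M :: "('n \<Rightarrow> int) \<Rightarrow> 'f" and L :: "'n \<Rightarrow> 'n \<Rightarrow> int"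
  assumes Mq_frame: "toric_frame qh Mq L" and M_frame: "toric_frame eh M L"
    and qh_transc: "evalp p qh = 0 \<Longrightarrow> p = 0"
begin

abbreviation spec :: "'g \<Rightarrow> 'f \<Rightarrow> bool" where
  "spec \<equiv> specializes qh Mq eh M"

lemma spec_add: "spec x y \<Longrightarrow> spec x' y' \<Longrightarrow> spec (x + x') (y + y')"
  by (induction rule: specializes.induct) (auto simp: add.assoc intro: specializes.step)

lemma spec_mono: "spec (of_int n * qh powi a * Mq f) (of_int n * eh powi a * M f)"
  using specializes.step[OF specializes.zero] by force

lemma spec_neg: "spec x y \<Longrightarrow> spec (- x) (- y)"
proof (induction rule: specializes.induct)
  case (step x y n a f)
  from specializes.step[OF step.IH, of "- n" a f] show ?case by simp
qed (simp add: specializes.zero)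

lemma spec_diff: "spec x y \<Longrightarrow> spec x' y' \<Longrightarrow> spec (x - x') (y - y')"
  using spec_add[OF _ spec_neg, of x y x' y'] by simp

lemma spec_mult:
  assumes "spec x y" "spec x' y'"
  shows "spec (x * x') (y * y')"
  using assms(1)
proof (induction rule: specializes.induct)
  case (step x y n a f)
  have "spec ((of_int n * qh powi a * Mq f) * x') ((of_int n * eh powi a * M f) * y')"
    using assms(2)
  proof (induction rule: specializes.induct)
    case (step x y m b g)
    then show ?case
      by (simp add: distrib_left q.monomial_mult[OF Mq_frame] e.monomial_mult[OF M_frame]
          spec_add spec_mono del: of_int_mult)
  qed (simp add: specializes.zero)
  with step.IH show ?case by (simp add: distrib_right spec_add)
qed (simp add: specializes.zero)

lemma spec_M: "spec (Mq f) (M f)"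
  using spec_mono[of 1 0 f] by simp

lemma spec_one: "spec 1 1"
  using spec_M[of 0] by (simp add: q.frame_zero[OF Mq_frame] e.frame_zero[OF M_frame])

lemma spec_powi: "spec (qh powi a) (eh powi a)"
  using spec_mono[of 1 a 0] by (simp add: q.frame_zero[OF Mq_frame] e.frame_zero[OF M_frame])

text \<open>In an expansion of 0 the coefficient polynomials vanish at \<open>qh\<close>, hence are
  zero by transcendence, and so they vanish at \<open>eh\<close> as well.\<close>

lemma spec_zero:
  assumes "spec 0 y"
  shows "y = 0"
proof -
  obtain S c where S: "finite S" "0 = (\<Sum>(f, a)\<in>S. of_int (c f a) * qh powi a * Mq f)"
    "y = (\<Sum>(f, a)\<in>S. of_int (c f a) * eh powi a * M f)"
    using specializes_sum_form[OF assms] by blast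
  define N where "N = (\<Sum>s\<in>S. nat \<bar>snd s\<bar>)"
  have N: "- int N \<le> a" if "(f, a) \<in> S" for f a
    using member_le_sum[OF that, of "\<lambda>s. nat \<bar>snd s\<bar>"] S(1) unfolding N_def[symmetric] by simp
  let ?p = "\<lambda>f. \<Sum>a | (f, a) \<in> S. monom (c f a) (nat (a + int N))"
  have "(\<Sum>f\<in>fst ` S. evalp (?p f) qh * Mq f) = 0"
    using q.sum_form_eval[OF S(1) N, where c = c and X = Mq] S(2) by simp
  then have "?p f = 0" if "f \<in> fst ` S" for f
    using q.frame_poly_indep[OF Mq_frame finite_imageI[OF S(1)] _ that, of ?p] qh_transc by simp
  then have "eh ^ N * y = 0"
    using e.sum_form_eval[OF S(1) N, where c = c and X = M] S(3) by simp
  then show ?thesis by simp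
qed

lemma spec_unique: "spec x y \<Longrightarrow> spec x y' \<Longrightarrow> y = y'"
  using spec_zero spec_diff by fastforce

lemma torus_spec: "x \<in> torus qh Mq \<Longrightarrow> \<exists>y. spec x y"
proof (induction rule: lspan.induct)
  case (step c f x)
  from step(1) have "\<exists>y. spec c y"
  proof (induction rule: subring_gen.induct)
    case (base x)
    then show ?case using spec_powi[of 1] spec_powi[of "-1"] by auto
  qed (blast intro: specializes.zero spec_one spec_add spec_neg spec_mult)+
  with step show ?case by (blast intro: spec_add spec_mult spec_M)
qed (blast intro: specializes.zero)

text \<open>Exponents are nonnegative because the inverse of a later cluster variable need not lie
  in the initial torus.\<close>

lemma spec_monomial:
  assumes "toric_frame qh Nq L'" "toric_frame eh N L'" "\<And>i. spec (Nq (unitv i)) (N (unitv i))"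
    and "\<And>i. 0 \<le> f i"
  shows "spec (Nq f) (N f)"
proof (rule vec_induct[where P = "\<lambda>f. spec (Nq f) (N f)" and f = f])
  show "spec (Nq 0) (N 0)"
    by (simp add: q.frame_zero[OF assms(1)] e.frame_zero[OF assms(2)] spec_one)
  show "spec (Nq (f + g)) (N (f + g))" if "spec (Nq f) (N f)" "spec (Nq g) (N g)" for f g
    unfolding q.frame_add[OF assms(1)] e.frame_add[OF assms(2)]
    by (intro spec_mult spec_powi that)
  show "spec (Nq (- unitv i)) (N (- unitv i))" if "f i < 0" for i
    using assms(4)[of i] that by simp
qed (rule assms(3))

end

text \<open>Multiplying the exchange relation by \<open>M (unitv k)\<close> leaves only monomials with
  nonnegative exponents on the right, which specialize by assumption.\<close>

lemma (in seed_mutation) exchange_product: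
  "M' (unitv j) * M (unitv j) = h powi bil L (pexp j B) (unitv j) * M (pexp j B + unitv j) +
     h powi bil L (nexp j B) (unitv j) * M (nexp j B + unitv j)"
  by (simp add: M'_j distrib_right M_mult)

section \<open>Matching quantum and root of unity mutation sequences\<close>

locale specialized_seeds = specialization qh eh Mq M L +
  q: seed qh ex d B L Mq + e: seed eh ex d B L M
  for qh :: "'g::division_ring" and eh :: "'f::division_ring"
    and Mq :: "('n::finite \<Rightarrow> int) \<Rightarrow> 'g" and M :: "('n \<Rightarrow> int) \<Rightarrow> 'f"
    and L :: "'n \<Rightarrow> 'n \<Rightarrow> int" and ex :: "'n set" and d B
begin

lemma spec_mutation:
  assumes reach: "(mut_step ex (toric_frame qh))\<^sup>*\<^sup>* (Mq, B, L) (Nq, B', L')"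
    and seeds: "seed qh ex d B' L' Nq" "seed eh ex d B' L' N"
    and vars: "\<And>i. spec (Nq (unitv i)) (N (unitv i))"
    and k: "k \<in> ex" and mutq: "mut_at qh k Nq B' L' Nq'" and mute: "mut_at eh k N B' L' N'"
  shows "spec (Nq' (unitv i)) (N' (unitv i))"
proof (cases "i = k")
  case False
  then show ?thesis using vars[of i] mutq mute by (simp add: mut_at_def)
next
  case True
  interpret mq: seed_mutation qh ex d B' L' Nq k Nq'
    using seeds(1) k mutq by (simp add: seed_mutation_def seed_mutation_axioms_def)
  interpret me: seed_mutation eh ex d B' L' N k N'
    using seeds(2) k mute by (simp add: seed_mutation_def seed_mutation_axioms_def)
  have nonneg: "0 \<le> (pexp k B' + unitv k) i" "0 \<le> (nexp k B' + unitv k) i" for i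
    by (simp_all add: pexp_def nexp_def)
  have "mut_step ex (toric_frame qh) (Nq, B', L') (Nq', mutB k B', mutL k B' L')"
    using k mutq by (auto simp: mut_step_iff)
  with reach have "Nq' (unitv k) \<in> torus qh Mq"
    by (intro q.laurent_phenomenon) (rule rtranclp.rtrancl_into_rtrancl)
  then obtain y where y: "spec (Nq' (unitv k)) y" using torus_spec by blast
  have "spec (Nq' (unitv k) * Nq (unitv k)) (y * N (unitv k))"
    by (rule spec_mult[OF y vars])
  moreover have "spec (Nq' (unitv k) * Nq (unitv k)) (N' (unitv k) * N (unitv k))"
    unfolding mq.exchange_product me.exchange_product
    by (intro spec_add spec_mult spec_powi spec_monomial[OF mq.frame me.frame vars] nonneg)
  ultimately have "y * N (unitv k) = N' (unitv k) * N (unitv k)" by (rule spec_unique)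
  with y True show ?thesis by simp
qed

lemma quantum_to_classical:
  assumes "(mut_step ex (toric_frame qh))\<^sup>*\<^sup>* (Mq, B, L) (Nq, B', L')"
  shows "\<exists>N. (mut_step ex (toric_frame eh))\<^sup>*\<^sup>* (M, B, L) (N, B', L') \<and>
    (\<forall>i. spec (Nq (unitv i)) (N (unitv i)))"
  using assms
proof (induction "(Nq, B', L')" arbitrary: Nq B' L' rule: rtranclp_induct)
  case base
  show ?case by (rule exI[of _ M]) (simp add: spec_M)
next
  case (step s)
  obtain Nq0 B0 L0 where s: "s = (Nq0, B0, L0)" by (cases s)
  then obtain N0 where N0: "(mut_step ex (toric_frame eh))\<^sup>*\<^sup>* (M, B, L) (N0, B0, L0)"
    "\<And>i. spec (Nq0 (unitv i)) (N0 (unitv i))" using step by blast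
  obtain k where k: "k \<in> ex" "B' = mutB k B0" "L' = mutL k B0 L0" "mut_at qh k Nq0 B0 L0 Nq"
    using step(2) unfolding s mut_step_iff by auto
  have seeds: "seed qh ex d B0 L0 Nq0" "seed eh ex d B0 L0 N0"
    using q.reachable step(1) s e.reachable[OF N0(1)] by auto
  obtain N where N: "mut_at eh k N0 B0 L0 N" using seed.mut_exists[OF seeds(2) k(1)] by blast
  have "mut_step ex (toric_frame eh) (N0, B0, L0) (N, B', L')"
    using k N by (auto simp: mut_step_iff)
  with N0(1) have "(mut_step ex (toric_frame eh))\<^sup>*\<^sup>* (M, B, L) (N, B', L')" by simp
  moreover have "spec (Nq (unitv i)) (N (unitv i))" for i
    using spec_mutation[OF _ seeds N0(2) k(1,4) N] step(1) s by blast
  ultimately show ?case by blast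
qed

lemma classical_to_quantum:
  assumes "(mut_step ex (toric_frame eh))\<^sup>*\<^sup>* (M, B, L) (N, B', L')"
  shows "\<exists>Nq. (mut_step ex (toric_frame qh))\<^sup>*\<^sup>* (Mq, B, L) (Nq, B', L') \<and>
    (\<forall>i. spec (Nq (unitv i)) (N (unitv i)))"
  using assms
proof (induction "(N, B', L')" arbitrary: N B' L' rule: rtranclp_induct)
  case base
  show ?case by (rule exI[of _ Mq]) (simp add: spec_M)
next
  case (step s)
  obtain N0 B0 L0 where s: "s = (N0, B0, L0)" by (cases s)
  then obtain Nq0 where Nq0: "(mut_step ex (toric_frame qh))\<^sup>*\<^sup>* (Mq, B, L) (Nq0, B0, L0)"
    "\<And>i. spec (Nq0 (unitv i)) (N0 (unitv i))" using step by blast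
  obtain k where k: "k \<in> ex" "B' = mutB k B0" "L' = mutL k B0 L0" "mut_at eh k N0 B0 L0 N"
    using step(2) unfolding s mut_step_iff by auto
  have seeds: "seed qh ex d B0 L0 Nq0" "seed eh ex d B0 L0 N0"
    using e.reachable step(1) s q.reachable[OF Nq0(1)] by auto
  obtain Nq where Nq: "mut_at qh k Nq0 B0 L0 Nq" using seed.mut_exists[OF seeds(1) k(1)] by blast
  have "mut_step ex (toric_frame qh) (Nq0, B0, L0) (Nq, B', L')"
    using k Nq by (auto simp: mut_step_iff)
  with Nq0(1) have "(mut_step ex (toric_frame qh))\<^sup>*\<^sup>* (Mq, B, L) (Nq, B', L')" by simp
  moreover have "spec (Nq (unitv i)) (N (unitv i))" for i
    using spec_mutation[OF Nq0(1) seeds Nq0(2) k(1) Nq k(4)] .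
  ultimately show ?case by blast
qed

text \<open>The inverse of \<open>eh\<close> is not among the generators of the root of unity algebra; it is
  a power of \<open>eh\<close>.\<close>

lemma kappa_image_cluster_algebra:
  fixes invs :: "'n set"
  assumes root: "eh ^ l = 1" "0 < l"
  defines "Gq \<equiv> {qh, inverse qh} \<union> cluster_vars ex (toric_frame qh) Mq B L
       \<union> {inverse (Mq (unitv j)) | j. j \<in> invs}"
    and "Ge \<equiv> {eh} \<union> cluster_vars ex (toric_frame eh) M B L
       \<union> {inverse (M (unitv j)) | j. j \<in> invs}"
  shows "kappa_image qh Mq eh M (subring_gen Gq) = subring_gen Ge"
proof -
  have spec_inverse: "spec (inverse (Mq f)) (inverse (M f))" for f
    using spec_M[of "- f"] by (simp add: q.M_neg e.M_neg)
  have "\<exists>y\<in>subring_gen Ge. spec x y" if "x \<in> subring_gen Gq" for x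
    using that
  proof (induction rule: subring_gen.induct)
    case (base x)
    then consider "x = qh" | "x = inverse qh" | "x \<in> cluster_vars ex (toric_frame qh) Mq B L"
      | j where "j \<in> invs" "x = inverse (Mq (unitv j))" unfolding Gq_def by blast
    then show ?case
    proof cases
      case 1
      then show ?thesis using spec_powi[of 1] by (auto simp: Ge_def intro: subring_gen.base)
    next
      case 2
      have "eh * eh ^ (l - 1) = 1" using root by (cases l) auto
      then have "inverse eh = eh ^ (l - 1)" by (rule inverse_unique)
      then have "inverse eh \<in> subring_gen Ge"
        by (simp add: Ge_def subring_gen_power subring_gen.base)
      then show ?thesis using 2 spec_powi[of "-1"] by auto
    next
      case 3
      then obtain Nq B' L' i where N: "(mut_step ex (toric_frame qh))\<^sup>*\<^sup>* (Mq, B, L) (Nq, B', L')"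
        "x = Nq (unitv i)" unfolding cluster_vars_def by blast
      then obtain N where "(mut_step ex (toric_frame eh))\<^sup>*\<^sup>* (M, B, L) (N, B', L')"
        "spec x (N (unitv i))" using quantum_to_classical by blast
      then show ?thesis unfolding Ge_def cluster_vars_def
        by (intro bexI[of _ "N (unitv i)"] subring_gen.base) auto
    next
      case 4
      then show ?thesis unfolding Ge_def
        by (intro bexI[of _ "inverse (M (unitv j))"] subring_gen.base) (auto simp: spec_inverse)
    qed
  qed (blast intro: subring_gen.intros specializes.zero spec_one spec_add spec_neg spec_mult)+
  moreover have "\<exists>x\<in>subring_gen Gq. spec x y" if "y \<in> subring_gen Ge" for y
    using that
  proof (induction rule: subring_gen.induct)
    case (base y)
    then consider "y = eh" | "y \<in> cluster_vars ex (toric_frame eh) M B L"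
      | j where "j \<in> invs" "y = inverse (M (unitv j))" unfolding Ge_def by blast
    then show ?case
    proof cases
      case 1
      then show ?thesis using spec_powi[of 1] by (auto simp: Gq_def intro: subring_gen.base)
    next
      case 2
      then obtain N B' L' i where N: "(mut_step ex (toric_frame eh))\<^sup>*\<^sup>* (M, B, L) (N, B', L')"
        "y = N (unitv i)" unfolding cluster_vars_def by blast
      then obtain Nq where "(mut_step ex (toric_frame qh))\<^sup>*\<^sup>* (Mq, B, L) (Nq, B', L')"
        "spec (Nq (unitv i)) y" using classical_to_quantum by blast
      then show ?thesis unfolding Gq_def cluster_vars_def
        by (intro bexI[of _ "Nq (unitv i)"] subring_gen.base) auto
    next
      case 3
      then show ?thesis unfolding Gq_def
        by (intro bexI[of _ "inverse (Mq (unitv j))"] subring_gen.base) (auto simp: spec_inverse)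
    qed
  qed (blast intro: subring_gen.intros specializes.zero spec_one spec_add spec_neg spec_mult)+
  ultimately show ?thesis
    unfolding kappa_image_eq using spec_unique by blast
qed

end

theorem theorem5p7:
  fixes l :: nat and \<zeta> :: complex
    and eh :: "'f::division_ring" and qh :: "'g::division_ring"
    and ex invs :: "'n::finite set"
    and Bt Lam :: "'n \<Rightarrow> 'n \<Rightarrow> int" and d :: "'n \<Rightarrow> int"
    and M :: "('n \<Rightarrow> int) \<Rightarrow> 'f" and Mq :: "('n \<Rightarrow> int) \<Rightarrow> 'g"
  assumes l_pos: "0 < l"
    and zeta_prim: "\<zeta> ^ l = 1" "\<forall>k. 0 < k \<and> k < l \<longrightarrow> \<zeta> ^ k \<noteq> 1"
    and eh_central: "central eh"
    and eh_zeta: "\<forall>p. evalp p eh = 0 \<longleftrightarrow> evalp p \<zeta> = 0"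
    and qh_central: "central qh"
    and qh_transc: "\<forall>p. evalp p qh = 0 \<longrightarrow> p = 0"
    and Lam_skew: "\<forall>i j. Lam i j = - Lam j i"
    and d_pos: "\<forall>j\<in>ex. 0 < d j"
    and DB_skew: "\<forall>i\<in>ex. \<forall>j\<in>ex. d i * Bt i j = - (d j * Bt j i)"
    and compat: "\<forall>j\<in>ex. \<forall>i. (\<Sum>k\<in>UNIV. Bt k j * Lam k i) = (if i = j then d j else 0)"
    and M_frame: "rou_frame l eh M Lam"
    and Mq_frame: "q_frame qh Mq Lam"
    and inv_sub: "invs \<subseteq> UNIV - ex"
  shows "alg_iso_eps eh (kappa_image qh Mq eh M (A_q qh ex Mq Bt Lam invs))
                        (A_eps l eh ex M Bt Lam invs)"
proof -
  \<comment> \<open>This is the polynomial \<open>x ^ l - 1\<close>; \<open>eh_zeta\<close>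
    transfers its root \<open>\<zeta>\<close> to \<open>eh\<close>.\<close>
  have "evalp (monom 1 l + - 1) \<zeta> = 0"
    unfolding evalp_add evalp_minus evalp_monom by (simp add: zeta_prim)
  then have "evalp (monom 1 l + - 1) eh = 0" using eh_zeta by blast
  then have root: "eh ^ l = 1"
    unfolding evalp_add evalp_minus evalp_monom by simp
  then have eh_nz: "eh \<noteq> 0" using l_pos by (auto simp: power_0_left)
  have "evalp [:0, 1:] qh = qh" by (simp add: evalp_pCons)
  then have qh_nz: "qh \<noteq> 0" using qh_transc by fastforce
  note rou = rou_frame_eq[OF root l_pos eh_nz] and qf = q_frame_eq[OF qh_transc]
  interpret specialized_seeds qh eh Mq M Lam ex d Bt
    using eh_central qh_central eh_nz qh_nz Lam_skew d_pos compat M_frame Mq_frame qh_transc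
    unfolding central_def rou qf by unfold_locales blast+
  have "kappa_image qh Mq eh M (A_q qh ex Mq Bt Lam invs) = A_eps l eh ex M Bt Lam invs"
    unfolding A_q_def A_eps_def rou qf by (rule kappa_image_cluster_algebra[OF root l_pos])
  then show ?thesis
    unfolding alg_iso_eps_def by (intro exI[of _ id]) auto
qed

end
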